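(* Let $d\ge2$, $a,b>0$, and let $c_1,c_2:[0,1]\to\mathbb R^d$ be two piecewise linear curves with values in $\mathbb R^d$. Then the pair of generalized reparametrizations $\gamma_1,\gamma_2\in\bar\Gamma$ that attains the infimum in $$\inf_{\gamma_1,\gamma_2\in\bar\Gamma}\operatorname{dist}_{a,b}(c_1\circ\gamma_1,c_2\circ\gamma_2)$$ consists of two piecewise linear maps.
   Context: A piecewise linear curve is a continuous map $[0,1]\to\mathbb R^d$ that is affine on each interval of some finite partition of $[0,1]$. $\bar\Gamma=\{\gamma\in AC([0,1],[0,1]):\gamma(0)=0,\ \gamma(1)=1,\ \gamma'\ge0\text{ a.e.}\}$, with $AC$ denoting absolutely continuous functions. For absolutely continuous curves $c_1,c_2:[0,1]\to\mathbb R^d$ (considered modulo translation), with $\ell_c=\int_0^1|c'|\,du$ the length of $c$, $$\operatorname{dist}_{a,b}(c_1,c_2)=2b\sqrt{\ell_{c_1}+\ell_{c_2}-2\int_0^1\sqrt{|c_1'||c_2'|}\cos\left(\tfrac{a}{2b}\theta\right)du},$$ where $\theta(u)=\min\left(\cos^{-1}\left(\frac{c_1'(u)\cdot c_2'(u)}{|c_1'(u)||c_2'(u)|}\right),\frac{2b\pi}{a}\right)$ if $c_1'(u),c_2'(u)\ne0$, and $\theta(u)=\frac{2b\pi}{a}$ otherwise. The infimum in the claim equals the induced distance $\operatorname{dist}^{\mathcal S}_{a,b}([c_1],[c_2])=\inf_{\gamma\in\Gamma}\operatorname{dist}_{a,b}(c_1,c_2\circ\gamma)$ between the unparametrized curves,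 where $\Gamma=\{\gamma\in AC([0,1],[0,1]):\gamma(0)=0,\ \gamma(1)=1,\ \gamma'>0\text{ a.e.}\}$. *)

theory Defs
  imports "HOL-Analysis.Analysis"
begin

(* Curves on [0,1] are functions real => _ of which only the values on {0..1} matter; all
   derivatives are therefore taken within {0..1}. *)

definition piecewise_linear :: "(real \<Rightarrow> 'a::real_normed_vector) \<Rightarrow> bool" where
  "piecewise_linear c \<longleftrightarrow> continuous_on {0..1} c \<and>
     (\<exists>(n::nat) (t::nat \<Rightarrow> real). t 0 = 0 \<and> t n = 1 \<and> (\<forall>i<n. t i < t (Suc i)) \<and>
        (\<forall>i<n. \<exists>p v. \<forall>u\<in>{t i..t (Suc i)}. c u = p + u *\<^sub>R v))"

definition absolutely_continuous_curve :: "(real \<Rightarrow> 'a::real_normed_vector) \<Rightarrow> bool" where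
  "absolutely_continuous_curve c \<longleftrightarrow>
     (\<forall>\<epsilon>>0. \<exists>\<delta>>0. \<forall>(n::nat) (l::nat \<Rightarrow> real) (r::nat \<Rightarrow> real).
        (\<forall>i<n. 0 \<le> l i \<and> l i \<le> r i \<and> r i \<le> 1) \<and>
        disjoint_family_on (\<lambda>i. {l i<..<r i}) {..<n} \<and>
        (\<Sum>i<n. r i - l i) < \<delta> \<longrightarrow>
        (\<Sum>i<n. norm (c (r i) - c (l i))) < \<epsilon>)"

definition Gamma_bar :: "(real \<Rightarrow> real) set" where
  "Gamma_bar = {\<gamma>. \<gamma> ` {0..1} \<subseteq> {0..1} \<and> absolutely_continuous_curve \<gamma> \<and>
     \<gamma> 0 = 0 \<and> \<gamma> 1 = 1 \<and>
     (AE u in lebesgue_on {0..1}. \<exists>D\<ge>0. (\<gamma> has_real_derivative D) (at u within {0..1}))}"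

(* For absolutely continuous c this is the derivative at almost every u in {0..1}; the
   unspecified values on the remaining null set do not affect the integrals below. *)
definition curve_deriv :: "(real \<Rightarrow> 'a::real_normed_vector) \<Rightarrow> real \<Rightarrow> 'a" where
  "curve_deriv c u = vector_derivative c (at u within {0..1})"

definition curve_length :: "(real \<Rightarrow> 'a::real_normed_vector) \<Rightarrow> real" where
  "curve_length c = (LINT u:{0..1}|lebesgue. norm (curve_deriv c u))"

definition curve_angle ::
    "real \<Rightarrow> real \<Rightarrow> (real \<Rightarrow> 'a::real_inner) \<Rightarrow> (real \<Rightarrow> 'a) \<Rightarrow> real \<Rightarrow> real" where
  "curve_angle a b c1 c2 u =
     (if curve_deriv c1 u \<noteq> 0 \<and> curve_deriv c2 u \<noteq> 0
      then min (arccos ((curve_deriv c1 u \<bullet> curve_deriv c2 u) /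
                        (norm (curve_deriv c1 u) * norm (curve_deriv c2 u))))
               (2 * b * pi / a)
      else 2 * b * pi / a)"

definition dist_ab ::
    "real \<Rightarrow> real \<Rightarrow> (real \<Rightarrow> 'a::real_inner) \<Rightarrow> (real \<Rightarrow> 'a) \<Rightarrow> real" where
  "dist_ab a b c1 c2 =
     2 * b * sqrt (curve_length c1 + curve_length c2
       - 2 * (LINT u:{0..1}|lebesgue.
                sqrt (norm (curve_deriv c1 u) * norm (curve_deriv c2 u))
                * cos (a / (2 * b) * curve_angle a b c1 c2 u)))"

end

theory Submission
  imports Defs
begin

text \<open>
  The length terms of the distance do not change under generalized reparametrizations
  (\<open>curve_length_reparametrized\<close>), so minimizing the distance means maximizing the integral of the
  matching density, \<open>pairing a b\<close> evaluated at the two velocities. This density vanishes where one of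
  the curves stands still. The breakpoints of the two polygonal curves cut the unit square, in
  which the path \<open>u \<mapsto> (\<eta>1 u, \<eta>2 u)\<close> ascends, into cells. On a cell the curves have constant
  velocities \<open>v\<close> and \<open>w\<close>, and since \<open>pairing\<close> is homogeneous of degree one half in each argument,
  the density there equals \<open>sqrt (\<eta>1' * \<eta>2') * pairing a b v w\<close>. By the Cauchy--Schwarz inequality
  a piece of path from \<open>(x, y)\<close> to \<open>(x', y')\<close> inside the cell contributes at most the positive part of
  \<open>sqrt ((x' - x) * (y' - y)) * pairing a b v w\<close> (\<open>matching_cell\<close>). The straight segment attains this
  value when the pairing is nonnegative; otherwise a horizontal segment followed by a vertical one attains 0.
  
  This leaves a finite-dimensional problem. Let \<open>reach k\<close> be the set of pairs of an end point in the
  square and a total gain that some chain of \<open>k\<close> horizontal, vertical or in-cell segments from the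
  origin produces. Three facts carry the proof. Every path is dominated by a chain whose number
  of segments depends only on the grid (\<open>matching_dominated_grid\<close>): an induction over the grid lines,
  cutting the path at the last grid line that it crosses. The set \<open>reach k\<close> is compact
  (\<open>compact_reach\<close>), so that a largest gain at the corner \<open>(1, 1)\<close> exists. Every element of
  \<open>reach k\<close> comes from two piecewise linear maps (\<open>reach_realized\<close>). The maps realizing the largest gain
  attain the infimum.
  
  Absolute continuity enters through one form of the fundamental theorem of calculus
  (\<open>absolutely_continuous_curve_has_integral_derivative\<close>): the almost-everywhere derivative integrates back to the
  function. It gives monotonicity of generalized reparametrizations, invariance of length and
  the values \<open>x' - x\<close>, \<open>y' - y\<close> in the Cauchy--Schwarz bound.
\<close>

section \<open>The fundamental theorem of calculus for absolutely continuous functions\<close>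

text \<open>
  The tagged intervals of a division are indexed by a finite set rather than by an initial segment of
  the naturals, so the defining condition has to be transported along an enumeration.
\<close>
lemma absolutely_continuous_curve_finite_family:
  fixes c :: "real \<Rightarrow> 'a::real_normed_vector"
  assumes "absolutely_continuous_curve c" "0 < \<epsilon>"
  obtains \<delta> where "0 < \<delta>"
    "\<And>(I::'i set) l r. \<lbrakk>finite I; \<And>i. i \<in> I \<Longrightarrow> 0 \<le> l i \<and> l i \<le> r i \<and> r i \<le> 1;
        disjoint_family_on (\<lambda>i. {l i<..<r i}) I; (\<Sum>i\<in>I. r i - l i) < \<delta>\<rbrakk>
      \<Longrightarrow> (\<Sum>i\<in>I. norm (c (r i) - c (l i))) < \<epsilon>"
proof -
  obtain \<delta> where \<delta>: "0 < \<delta>" and ac: "\<And>(n::nat) l r. \<lbrakk>\<forall>i<n. 0 \<le> l i \<and> l i \<le> r i \<and> r i \<le> 1;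
      disjoint_family_on (\<lambda>i. {l i<..<r i}) {..<n}; (\<Sum>i<n. r i - l i) < \<delta>\<rbrakk>
      \<Longrightarrow> (\<Sum>i<n. norm (c (r i) - c (l i))) < \<epsilon>"
    using assms(1)[unfolded absolutely_continuous_curve_def, rule_format, OF assms(2)] by blast
  show thesis
  proof (rule that[OF \<delta>])
    fix I :: "'i set" and l r
    assume I: "finite I" and lr: "\<And>i. i \<in> I \<Longrightarrow> 0 \<le> l i \<and> l i \<le> r i \<and> r i \<le> 1"
      and disj: "disjoint_family_on (\<lambda>i. {l i<..<r i}) I" and sm: "(\<Sum>i\<in>I. r i - l i) < \<delta>"
    obtain h where h: "bij_betw h {..<card I} I"
      using I ex_bij_betw_nat_finite[of I] by (auto simp: atLeast0LessThan)
    have hI: "h k \<in> I" if "k < card I" for k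
      using h that by (auto simp: bij_betw_def)
    have "disjoint_family_on (\<lambda>k. {(l \<circ> h) k<..<(r \<circ> h) k}) {..<card I}"
      unfolding disjoint_family_on_def
    proof (intro ballI impI)
      fix j k assume jk: "j \<in> {..<card I}" "k \<in> {..<card I}" "j \<noteq> k"
      then have "h j \<noteq> h k" using h by (metis bij_betw_imp_inj_on inj_onD)
      with jk show "{(l \<circ> h) j<..<(r \<circ> h) j} \<inter> {(l \<circ> h) k<..<(r \<circ> h) k} = {}"
        using disjoint_family_onD[OF disj hI hI] unfolding comp_def by blast
    qed
    moreover have "(\<Sum>k<card I. (r \<circ> h) k - (l \<circ> h) k) < \<delta>"
      using sm sum.reindex_bij_betw[OF h, of "\<lambda>i. r i - l i"] by simp
    ultimately have "(\<Sum>k<card I. norm (c ((r \<circ> h) k) - c ((l \<circ> h) k))) < \<epsilon>"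
      using lr hI by (intro ac) auto
    then show "(\<Sum>i\<in>I. norm (c (r i) - c (l i))) < \<epsilon>"
      using sum.reindex_bij_betw[OF h, of "\<lambda>i. norm (c (r i) - c (l i))"] by simp
  qed
qed

lemma tagged_division_real_interval:
  fixes a b :: real
  assumes p: "p tagged_division_of {a..b}" and xk: "(x, k) \<in> p"
  shows "k = {Inf k..Sup k}" "Inf k \<le> x" "x \<le> Sup k" "a \<le> Inf k" "Sup k \<le> b" "measure lborel k = Sup k - Inf k"
    "interior k = {Inf k<..<Sup k}"
proof -
  obtain l r where k: "k = {l..r}"
    using tagged_division_ofD(4)[OF p xk] by (auto simp: cbox_interval)
  have xk': "x \<in> k" "k \<subseteq> {a..b}"
    using tagged_division_ofD[OF p] xk by auto
  then have lr: "l \<le> r" using k by auto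
  then have "Inf k = l" "Sup k = r" using k by auto
  then show "k = {Inf k..Sup k}" "Inf k \<le> x" "x \<le> Sup k" "a \<le> Inf k" "Sup k \<le> b" "measure lborel k = Sup k - Inf k"
    "interior k = {Inf k<..<Sup k}"
    using k lr xk' by auto
qed

text \<open>
  A gauge proof. At a point outside the exceptional null set, differentiability makes the Riemann
  summand differ from the increment of \<open>f\<close> by at most a small multiple of the length of the interval. The null set lies in an
  open set of small measure; the gauge keeps the intervals tagged in the null set inside this open set, so their
  total length is small, and absolute continuity makes the total increment of \<open>f\<close> over them small.
\<close>
lemma absolutely_continuous_curve_has_integral_derivative:
  fixes f g :: "real \<Rightarrow> real"
  assumes ac: "absolutely_continuous_curve f" and E: "negligible E"
    and der: "\<And>x. x \<in> {0..1} - E \<Longrightarrow> (f has_real_derivative g x) (at x within {0..1})"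
    and ab: "0 \<le> a" "a \<le> b" "b \<le> 1"
  shows "(g has_integral (f b - f a)) {a..b}"
proof -
  define G where "G x = (if x \<in> E then 0 else g x)" for x
  have "(G has_integral (f b - f a)) {a..b}"
    unfolding has_integral_real
  proof (intro allI impI)
    fix e :: real assume e: "0 < e"
    define e' where "e' = e / 4"
    have e': "0 < e'" using e by (simp add: e'_def)
    obtain \<delta> where \<delta>: "0 < \<delta>" and small: "\<And>(I::(real \<times> real set) set) l r. \<lbrakk>finite I; \<And>i. i \<in> I \<Longrightarrow> 0 \<le> l i \<and> l i \<le> r i \<and> r i \<le> 1;
        disjoint_family_on (\<lambda>i. {l i<..<r i}) I; (\<Sum>i\<in>I. r i - l i) < \<delta>\<rbrakk>
      \<Longrightarrow> (\<Sum>i\<in>I. norm (f (r i) - f (l i))) < e'"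
      using absolutely_continuous_curve_finite_family[OF ac e'] by blast
    have E0: "E \<in> lmeasurable" "measure lebesgue E = 0"
      using E by (auto simp: negligible_iff_measure)
    obtain U where U: "open U" "E \<subseteq> U" "U - E \<in> lmeasurable" "emeasure lebesgue (U - E) < ennreal \<delta>"
      using sets_lebesgue_outer_open[OF fmeasurableD[OF E0(1)] \<delta>] by blast
    have Um: "U \<in> lmeasurable"
      using fmeasurable.Un[OF U(3) E0(1)] U(2) by (simp add: Un_absorb2)
    have "measure lebesgue U = measure lebesgue (U - E)"
      using measurable_measure_Diff[OF Um _ U(2)] E0 by simp
    also have "\<dots> < \<delta>"
      using U(3,4) \<delta> by (simp add: emeasure_eq_measure2 ennreal_less_iff)
    finally have U\<delta>: "measure lebesgue U < \<delta>" .
    \<comment> \<open>The gauge: it confines intervals tagged in \<open>E\<close> to \<open>U\<close> and linearizes \<open>f\<close> at all other tags.\<close>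
    have "\<exists>d>0. (x \<in> E \<longrightarrow> ball x d \<subseteq> U) \<and> (x \<in> {0..1} - E \<longrightarrow>
        (\<forall>y\<in>{0..1}. \<bar>y - x\<bar> < d \<longrightarrow> \<bar>f y - f x - g x * (y - x)\<bar> \<le> e' * \<bar>y - x\<bar>))" for x
    proof (cases "x \<in> E")
      case True
      then show ?thesis using U by (metis Diff_iff open_contains_ball subset_iff)
    next
      case False
      show ?thesis
      proof (cases "x \<in> {0..1}")
        case True
        with False der have "(f has_derivative (*) (g x)) (at x within {0..1})"
          by (auto simp: has_field_derivative_def)
        then obtain d where "d > 0" "\<forall>y\<in>{0..1}. norm (y - x) < d \<longrightarrow> norm (f y - f x - g x * (y - x)) \<le> e' * norm (y - x)"
          unfolding has_derivative_within_alt using e' by blast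
        with False show ?thesis by auto
      qed (use False in \<open>auto intro: exI[of _ 1]\<close>)
    qed
    then obtain d where d: "\<And>x. d x > 0" "\<And>x. x \<in> E \<Longrightarrow> ball x (d x) \<subseteq> U"
      "\<And>x y. \<lbrakk>x \<in> {0..1} - E; y \<in> {0..1}; \<bar>y - x\<bar> < d x\<rbrakk> \<Longrightarrow> \<bar>f y - f x - g x * (y - x)\<bar> \<le> e' * \<bar>y - x\<bar>"
      by metis
    show "\<exists>\<gamma>. gauge \<gamma> \<and> (\<forall>p. p tagged_division_of {a..b} \<and> \<gamma> fine p \<longrightarrow>
        norm ((\<Sum>(x, k)\<in>p. measure lborel k *\<^sub>R G x) - (f b - f a)) < e)"
    proof (intro exI conjI allI impI)
      show "gauge (\<lambda>x. ball x (d x))" using d(1) by (auto simp: gauge_def)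
      fix p assume "p tagged_division_of {a..b} \<and> (\<lambda>x. ball x (d x)) fine p"
      then have p: "p tagged_division_of {a..b}" and fine: "\<And>x k. (x, k) \<in> p \<Longrightarrow> k \<subseteq> ball x (d x)"
        by (auto simp: fine_def)
      note tr = tagged_division_real_interval[OF p]
      have finp: "finite p" using p by blast
      \<comment> \<open>The intervals tagged in \<open>E\<close>; there \<open>G\<close> is 0 and only the increments of \<open>f\<close> remain.\<close>
      define q where "q = {xk \<in> p. fst xk \<in> E}"
      have qp: "q \<subseteq> p" and finq: "finite q" using finp by (auto simp: q_def)
      define l r where "l = (\<lambda>xk::real \<times> real set. Inf (snd xk))" and "r = (\<lambda>xk::real \<times> real set. Sup (snd xk))"
      have lr: "0 \<le> l i \<and> l i \<le> r i \<and> r i \<le> 1" if "i \<in> p" for i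
        using tr[of "fst i" "snd i"] that ab by (auto simp: l_def r_def)
      have disj: "disjoint_family_on (\<lambda>i. {l i<..<r i}) q"
        unfolding disjoint_family_on_def
      proof (intro ballI impI)
        fix i j assume ij: "i \<in> q" "j \<in> q" "i \<noteq> j"
        then have ijp: "(fst i, snd i) \<in> p" "(fst j, snd j) \<in> p" "(fst i, snd i) \<noteq> (fst j, snd j)"
          using qp by auto
        then have "interior (snd i) \<inter> interior (snd j) = {}"
          by (rule tagged_division_ofD(5)[OF p])
        then show "{l i<..<r i} \<inter> {l j<..<r j} = {}"
          unfolding l_def r_def using tr(7)[OF ijp(1)] tr(7)[OF ijp(2)] by simp
      qed
      have "(\<Sum>i\<in>q. r i - l i) = (\<Sum>i\<in>q. measure lebesgue {l i<..<r i})"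
        using lr qp by (intro sum.cong) auto
      also have "\<dots> = measure lebesgue (\<Union>i\<in>q. {l i<..<r i})"
        by (rule measure_finite_Union[symmetric]) (use disj finq lr qp in \<open>auto simp: subset_iff\<close>)
      also have "\<dots> \<le> measure lebesgue U"
      proof (rule measure_mono_fmeasurable)
        show "(\<Union>i\<in>q. {l i<..<r i}) \<subseteq> U"
        proof (intro UN_least)
          fix i assume i: "i \<in> q"
          then have "snd i \<subseteq> ball (fst i) (d (fst i))" using fine[of "fst i" "snd i"] qp by auto
            moreover have "{l i<..<r i} \<subseteq> snd i"
            using tr(7)[of "fst i" "snd i"] i qp interior_subset[of "snd i"] unfolding l_def r_def by auto
          ultimately show "{l i<..<r i} \<subseteq> U" using d(2)[of "fst i"] i unfolding q_def by blast
        qed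
      qed (use Um finq in auto)
      finally have "(\<Sum>i\<in>q. r i - l i) < \<delta>" using U\<delta> by linarith
      then have "(\<Sum>i\<in>q. norm (f (r i) - f (l i))) < e'"
        using lr qp by (intro small[OF finq _ disj]) blast+
      moreover have "norm (measure lborel (snd i) *\<^sub>R G (fst i) - (f (r i) - f (l i))) = norm (f (r i) - f (l i))" if "i \<in> q" for i
        using that by (auto simp: q_def G_def)
      ultimately have 1: "(\<Sum>i\<in>q. norm (measure lborel (snd i) *\<^sub>R G (fst i) - (f (r i) - f (l i)))) < e'" by simp
      have step: "norm (measure lborel (snd i) *\<^sub>R G (fst i) - (f (r i) - f (l i))) \<le> e' * measure lborel (snd i)" if "i \<in> p - q" for i
      proof -
        obtain x k where i: "i = (x, k)" by force
        with that have xk: "(x, k) \<in> p" "x \<notin> E" by (auto simp: q_def)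
        note t = tr[OF xk(1)]
        have x01: "x \<in> {0..1} - E" using t ab xk by auto
        have "Inf k \<le> Sup k" using t(2,3) by linarith
        then have "Inf k \<in> {Inf k..Sup k}" "Sup k \<in> {Inf k..Sup k}" by simp_all
        then have "Inf k \<in> k" "Sup k \<in> k"
          unfolding t(1)[symmetric] .
        then have "Inf k \<in> ball x (d x)" "Sup k \<in> ball x (d x)"
          using fine[OF xk(1)] by blast+
        then have "\<bar>Inf k - x\<bar> < d x" "\<bar>Sup k - x\<bar> < d x"
          by (auto simp: dist_real_def abs_minus_commute)
        moreover have "Inf k \<in> {0..1}" "Sup k \<in> {0..1}" using t(2-5) ab by auto
        ultimately have "\<bar>f (Inf k) - f x - g x * (Inf k - x)\<bar> \<le> e' * \<bar>Inf k - x\<bar>"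
          "\<bar>f (Sup k) - f x - g x * (Sup k - x)\<bar> \<le> e' * \<bar>Sup k - x\<bar>"
          by (blast intro: d(3)[OF x01])+
        moreover have "measure lborel k * g x - (f (Sup k) - f (Inf k)) =
           (f (Inf k) - f x - g x * (Inf k - x)) - (f (Sup k) - f x - g x * (Sup k - x))"
          unfolding t(6) by (simp add: algebra_simps)
        moreover have "e' * \<bar>Inf k - x\<bar> + e' * \<bar>Sup k - x\<bar> = e' * measure lborel k"
          unfolding t(6) using t(2,3) by (simp add: algebra_simps)
        ultimately have "\<bar>measure lborel k * g x - (f (Sup k) - f (Inf k))\<bar> \<le> e' * measure lborel k"
          by linarith
        then show ?thesis
          unfolding i l_def r_def G_def using xk(2) by simp
      qed
      have "(\<Sum>i\<in>p - q. norm (measure lborel (snd i) *\<^sub>R G (fst i) - (f (r i) - f (l i)))) \<le> (\<Sum>i\<in>p - q. e' * measure lborel (snd i))"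
        by (intro sum_mono step)
      also have "\<dots> \<le> (\<Sum>i\<in>p. e' * measure lborel (snd i))"
        by (intro sum_mono2) (use finp e' in auto)
      also have "\<dots> = e' * (b - a)"
        using additive_content_tagged_division[of p a b] p ab
        by (simp add: sum_distrib_left[symmetric] case_prod_unfold box_real)
      also have "\<dots> \<le> e' * 1" using e' ab by (intro mult_left_mono) auto
      finally have 2: "(\<Sum>i\<in>p - q. norm (measure lborel (snd i) *\<^sub>R G (fst i) - (f (r i) - f (l i)))) \<le> e'" by simp
      have "(\<Sum>(x, k)\<in>p. measure lborel k *\<^sub>R G x) - (f b - f a) =
          (\<Sum>i\<in>p. measure lborel (snd i) *\<^sub>R G (fst i) - (f (r i) - f (l i)))"
        using additive_tagged_division_1[OF ab(2) p, of f]
        by (simp add: sum_subtractf case_prod_unfold l_def r_def)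
      then have "norm ((\<Sum>(x, k)\<in>p. measure lborel k *\<^sub>R G x) - (f b - f a)) \<le>
          (\<Sum>i\<in>p. norm (measure lborel (snd i) *\<^sub>R G (fst i) - (f (r i) - f (l i))))"
        by (simp add: norm_sum del: real_norm_def)
      also have "\<dots> < e' + e'"
        using 1 2 sum.subset_diff[OF qp finp, of "\<lambda>i. norm (measure lborel (snd i) *\<^sub>R G (fst i) - (f (r i) - f (l i)))"]
        by linarith
      also have "\<dots> < e" using e by (simp add: e'_def)
      finally show "norm ((\<Sum>(x, k)\<in>p. measure lborel k *\<^sub>R G x) - (f b - f a)) < e" .
    qed
  qed
  then show ?thesis
    by (rule has_integral_spike[OF E, rotated]) (auto simp: G_def)
qed

section \<open>Generalized reparametrizations\<close>

text \<open>
  All that is used of a generalized reparametrization. The speed is an everywhere nonnegative version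
  of the derivative, which avoids the arbitrary values of the derivative on the exceptional set.
\<close>
definition has_speed :: "(real \<Rightarrow> real) \<Rightarrow> (real \<Rightarrow> real) \<Rightarrow> bool" where
  "has_speed \<eta> g \<longleftrightarrow> \<eta> 0 = 0 \<and> \<eta> 1 = 1 \<and> (\<forall>u. 0 \<le> g u) \<and>
     (\<exists>N. negligible N \<and> (\<forall>u\<in>{0..1} - N. (\<eta> has_real_derivative g u) (at u within {0..1}))) \<and>
     (\<forall>x y. 0 \<le> x \<longrightarrow> x \<le> y \<longrightarrow> y \<le> 1 \<longrightarrow> (g has_integral (\<eta> y - \<eta> x)) {x..y})"

lemma AE_lebesgue_on_negligible:
  assumes "AE u in lebesgue_on {0..1::real}. P u"
  obtains N where "negligible N" "\<And>u. u \<in> {0..1} - N \<Longrightarrow> P u"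
proof -
  have "AE u in lebesgue. u \<in> {0..1} \<longrightarrow> P u"
    using assms by (simp add: AE_restrict_space_iff)
  then obtain N where "N \<in> null_sets lebesgue" "{u. \<not> (u \<in> {0..1} \<longrightarrow> P u)} \<subseteq> N"
    by (force elim!: AE_E3)
  then show thesis
    by (intro that[of N]) (auto simp: negligible_iff_null_sets)
qed

lemma Gamma_bar_has_speed:
  assumes "\<eta> \<in> Gamma_bar"
  obtains g where "has_speed \<eta> g"
proof -
  have ac: "absolutely_continuous_curve \<eta>" and ends: "\<eta> 0 = 0" "\<eta> 1 = 1"
    and ae: "AE u in lebesgue_on {0..1}. \<exists>D\<ge>0. (\<eta> has_real_derivative D) (at u within {0..1})"
    using assms by (auto simp: Gamma_bar_def)
  obtain N where N: "negligible N"
    "\<And>u. u \<in> {0..1} - N \<Longrightarrow> \<exists>D\<ge>0. (\<eta> has_real_derivative D) (at u within {0..1})"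
    using AE_lebesgue_on_negligible[OF ae] by blast
  then obtain D where D: "\<And>u. u \<in> {0..1} - N \<Longrightarrow> 0 \<le> D u \<and> (\<eta> has_real_derivative D u) (at u within {0..1})"
    by metis
  define g where "g u = (if u \<in> {0..1} - N then D u else 0)" for u
  have g: "(\<eta> has_real_derivative g u) (at u within {0..1})" if "u \<in> {0..1} - N" for u
    using D that by (auto simp: g_def)
  have "0 \<le> g u" for u
    using D by (auto simp: g_def)
  then have "has_speed \<eta> g"
    unfolding has_speed_def
    using ends N(1) g absolutely_continuous_curve_has_integral_derivative[OF ac N(1) g]
    by blast
  then show thesis by (rule that)
qed

lemma has_speed_nonneg: "has_speed \<eta> g \<Longrightarrow> 0 \<le> g u"
  by (simp add: has_speed_def)

lemma has_speed_integral:
  "has_speed \<eta> g \<Longrightarrow> 0 \<le> x \<Longrightarrow> x \<le> y \<Longrightarrow> y \<le> 1 \<Longrightarrow> (g has_integral (\<eta> y - \<eta> x)) {x..y}"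
  by (simp add: has_speed_def)

lemma has_speed_mono:
  assumes "has_speed \<eta> g" "0 \<le> x" "x \<le> y" "y \<le> 1"
  shows "\<eta> x \<le> \<eta> y"
  using has_integral_nonneg[OF has_speed_integral[OF assms]] has_speed_nonneg[OF assms(1)] by simp

lemma has_speed_range:
  assumes "has_speed \<eta> g" "u \<in> {0..1}"
  shows "\<eta> u \<in> {0..1}"
  using has_speed_mono[OF assms(1), of 0 u] has_speed_mono[OF assms(1), of u 1] assms
  by (auto simp: has_speed_def)

lemma has_speed_continuous:
  assumes "has_speed \<eta> g"
  shows "continuous_on {0..1} \<eta>"
proof -
  have "g integrable_on {0..1}"
    using has_speed_integral[OF assms, of 0 1] by (auto simp: integrable_on_def)
  then have "continuous_on {0..1} (\<lambda>u. integral {0..u} g)"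
    by (rule indefinite_integral_continuous_1)
  moreover have "integral {0..u} g = \<eta> u" if "u \<in> {0..1}" for u
    using has_speed_integral[OF assms, of 0 u] that assms by (auto simp: has_speed_def)
  ultimately show ?thesis
    using continuous_on_cong[of "{0..1}" "{0..1}" "\<lambda>u. integral {0..u} g" \<eta>] by auto
qed

lemma has_speed_IVT:
  assumes "has_speed \<eta> g" "u \<in> {0..1}" "0 \<le> x" "x \<le> \<eta> u"
  obtains u' where "0 \<le> u'" "u' \<le> u" "\<eta> u' = x"
  using IVT'[of \<eta> 0 x u] assms continuous_on_subset[OF has_speed_continuous[OF assms(1)], of "{0..u}"]
  by (auto simp: has_speed_def)

lemma has_speed_absolutely_integrable:
  assumes "has_speed \<eta> g" "0 \<le> x" "x \<le> y" "y \<le> 1"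
  shows "g absolutely_integrable_on {x..y}"
  using has_speed_integral[OF assms] has_speed_nonneg[OF assms(1)]
  by (intro nonnegative_absolutely_integrable_1) (auto simp: integrable_on_def)

lemma curve_deriv_eqI:
  assumes "0 < u" "u < 1" "(c has_vector_derivative v) (at u)"
  shows "curve_deriv c u = v"
proof -
  have "at u within {0..1} = at u"
    using assms by (intro at_within_interior) auto
  then show ?thesis
    using assms by (simp add: curve_deriv_def vector_derivative_at)
qed

text \<open>
  While \<open>\<eta>\<close> stays in one closed linear piece of the curve, the composition is an affine function of
  \<open>\<eta>\<close>. Its derivative therefore comes from that of \<open>\<eta>\<close> alone, also at times when \<open>\<eta>\<close> rests at a
  corner of \<open>c\<close>.
\<close>
lemma curve_deriv_affine_comp:
  assumes sp: "has_speed \<eta> g" and xy: "0 \<le> x" "y \<le> 1"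
    and st: "\<And>u. u \<in> {x..y} \<Longrightarrow> \<eta> u \<in> {s..t}"
    and c: "\<And>r. r \<in> {s..t} \<Longrightarrow> c r = p + r *\<^sub>R v"
  obtains N where "negligible N" "\<And>u. u \<in> {x..y} - N \<Longrightarrow> curve_deriv (c \<circ> \<eta>) u = g u *\<^sub>R v"
proof -
  obtain N where N: "negligible N" "\<And>u. u \<in> {0..1} - N \<Longrightarrow> (\<eta> has_real_derivative g u) (at u within {0..1})"
    using sp by (auto simp: has_speed_def)
  show thesis
  proof (rule that[of "N \<union> {x, y}"])
    show "negligible (N \<union> {x, y})" using N(1) by (simp add: negligible_Un)
    fix u assume u: "u \<in> {x..y} - (N \<union> {x, y})"
    then have u01: "0 < u" "u < 1" and uxy: "u \<in> {x<..<y}" using xy by auto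
    have "at u within {0..1} = at u"
      using u01 by (intro at_within_interior) auto
    then have "(\<eta> has_real_derivative g u) (at u)"
      using N(2)[of u] u u01 by auto
    then have "((\<lambda>u. p + \<eta> u *\<^sub>R v) has_vector_derivative g u *\<^sub>R v) (at u)"
      by (auto intro!: derivative_eq_intros simp: has_real_derivative_iff_has_vector_derivative)
    then have "((c \<circ> \<eta>) has_vector_derivative g u *\<^sub>R v) (at u)"
      by (rule has_vector_derivative_transform_within_open[of _ _ _ "{x<..<y}"])
        (use uxy st c in auto)
    then show "curve_deriv (c \<circ> \<eta>) u = g u *\<^sub>R v"
      using u01 by (intro curve_deriv_eqI)
  qed
qed

section \<open>Invariance of the length\<close>

lemma partition_mono:
  fixes t :: "nat \<Rightarrow> real"
  assumes "\<And>i. i < n \<Longrightarrow> t i < t (Suc i)" "i \<le> j" "j \<le> n"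
  shows "t i \<le> t j"
  using assms(2,3)
proof (induction j rule: dec_induct)
  case (step j)
  then show ?case using assms(1)[of j] by simp
qed simp

lemma absolutely_integrable_append:
  fixes f :: "real \<Rightarrow> real"
  assumes "f absolutely_integrable_on {x..y}" "f absolutely_integrable_on {y..z}" "x \<le> y" "y \<le> z"
  shows "f absolutely_integrable_on {x..z}"
    and "integral {x..z} f = integral {x..y} f + integral {y..z} f"
proof -
  show 1: "f absolutely_integrable_on {x..z}"
    using absolutely_integrable_Un[OF assms(1,2)] ivl_disj_un_two_touch(4)[OF assms(3,4)] by simp
  then show "integral {x..z} f = integral {x..y} f + integral {y..z} f"
    using Henstock_Kurzweil_Integration.integral_combine[OF assms(3,4), of f]
    by (simp add: absolutely_integrable_on_def)
qed

text \<open>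
  On the time interval in which \<open>\<eta>\<close> traverses a linear piece the speed is \<open>\<eta>'\<close> times a constant, and \<open>\<eta>'\<close>
  integrates to the length of the parameter interval of the piece. The times at which \<open>\<eta>\<close> meets the
  breakpoints exist by the intermediate value theorem.
\<close>
lemma curve_length_reparametrized:
  fixes c :: "real \<Rightarrow> 'a::euclidean_space"
  assumes sp: "has_speed \<eta> g" and s: "s 0 = 0" "s n = 1" "\<And>i. i < n \<Longrightarrow> s i < s (Suc i)"
    and c: "\<And>i u. i < n \<Longrightarrow> u \<in> {s i..s (Suc i)} \<Longrightarrow> c u = p i + u *\<^sub>R v i"
  shows "curve_length (c \<circ> \<eta>) = (\<Sum>i<n. (s (Suc i) - s i) * norm (v i))"
proof -
  let ?S = "\<lambda>u. norm (curve_deriv (c \<circ> \<eta>) u)"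
  have piece: "?S absolutely_integrable_on {x..y} \<and> integral {x..y} ?S = (\<eta> y - \<eta> x) * norm v0"
    if xy: "0 \<le> x" "x \<le> y" "y \<le> 1" and le: "\<sigma> \<le> \<eta> x" "\<eta> y \<le> \<sigma>'"
      and c: "\<And>r. r \<in> {\<sigma>..\<sigma>'} \<Longrightarrow> c r = p0 + r *\<^sub>R v0" for x y \<sigma> \<sigma>' p0 v0
  proof -
    have "\<eta> u \<in> {\<sigma>..\<sigma>'}" if "u \<in> {x..y}" for u
      using has_speed_mono[OF sp, of x u] has_speed_mono[OF sp, of u y] le that xy by auto
    then obtain N where N: "negligible N" "\<And>u. u \<in> {x..y} - N \<Longrightarrow> curve_deriv (c \<circ> \<eta>) u = g u *\<^sub>R v0"
      using curve_deriv_affine_comp[OF sp xy(1,3) _ c] by blast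
    have eq: "?S u = g u * norm v0" if "u \<in> {x..y} - N" for u
      using N(2)[OF that] has_speed_nonneg[OF sp] by simp
    have "(\<lambda>u. g u * norm v0) absolutely_integrable_on {x..y}"
      using has_speed_absolutely_integrable[OF sp xy] by (rule set_integrable_mult_left)
    then have "?S absolutely_integrable_on {x..y}"
      using N(1) eq by (rule absolutely_integrable_spike)
    moreover have "integral {x..y} ?S = integral {x..y} (\<lambda>u. g u * norm v0)"
      using N(1) eq by (rule integral_spike[symmetric]) auto
    ultimately show ?thesis
      using integral_unique[OF has_speed_integral[OF sp xy]] by simp
  qed
  have "?S absolutely_integrable_on {0..u} \<and> integral {0..u} ?S = (\<Sum>k<i. (s (Suc k) - s k) * norm (v k))"
    if "i \<le> n" "u \<in> {0..1}" "\<eta> u = s i" for i u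
    using that
  proof (induction i arbitrary: u)
    case 0
    have "\<eta> 0 = 0" using sp by (simp add: has_speed_def)
    with 0 piece[of 0 u 0 0 "c 0" 0] s(1) show ?case by (simp del: comp_apply)
  next
    case (Suc i)
    have i: "i < n" using Suc.prems by simp
    have "0 \<le> s i" using partition_mono[where t=s and n=n and i=0 and j=i, OF s(3)] s(1) i by auto
    moreover have "s i \<le> \<eta> u" using s(3)[OF i] Suc.prems by simp
    ultimately obtain x where x: "0 \<le> x" "x \<le> u" "\<eta> x = s i"
      using has_speed_IVT[OF sp Suc.prems(2)] by blast
    have u1: "u \<le> 1" using Suc.prems by simp
    have IH: "?S absolutely_integrable_on {0..x}" "integral {0..x} ?S = (\<Sum>k<i. (s (Suc k) - s k) * norm (v k))"
      using Suc.IH[of x] Suc.prems x i by (simp_all del: comp_apply)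
    have P: "?S absolutely_integrable_on {x..u}" "integral {x..u} ?S = (\<eta> u - \<eta> x) * norm (v i)"
      using piece[where \<sigma> = "s i" and \<sigma>' = "s (Suc i)", OF x(1,2) u1 _ _ c[OF i]] x(3) Suc.prems(3)
      by (simp_all del: comp_apply)
    show ?case
      using absolutely_integrable_append[OF IH(1) P(1) x(1,2)] IH(2) P(2) x(3) Suc.prems(3)
      by (simp del: comp_apply)
  qed
  from this[of n 1] sp s(2) show ?thesis
    by (simp add: curve_length_def set_lebesgue_integral_eq_integral has_speed_def)
qed

section \<open>The matching density and its bound on a cell\<close>

text \<open>
  The integrand of the distance as a function of the two velocities. The angle takes its capped value
  when a velocity vanishes, as in the distance; the factor in front is 0 then.
\<close>
definition pairing :: "real \<Rightarrow> real \<Rightarrow> 'a::real_inner \<Rightarrow> 'a \<Rightarrow> real" where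
  "pairing a b v w = sqrt (norm v * norm w) *
     cos (a / (2 * b) *
       (if v \<noteq> 0 \<and> w \<noteq> 0 then min (arccos ((v \<bullet> w) / (norm v * norm w))) (2 * b * pi / a)
        else 2 * b * pi / a))"

lemma pairing_zero [simp]: "pairing a b 0 w = 0" "pairing a b v 0 = 0"
  by (simp_all add: pairing_def)

lemma pairing_scaleR:
  assumes "0 \<le> x" "0 \<le> y"
  shows "pairing a b (x *\<^sub>R v) (y *\<^sub>R w) = sqrt (x * y) * pairing a b v w"
proof (cases "x = 0 \<or> y = 0 \<or> v = 0 \<or> w = 0")
  case False
  then have "(x *\<^sub>R v \<bullet> y *\<^sub>R w) / (norm (x *\<^sub>R v) * norm (y *\<^sub>R w)) = (v \<bullet> w) / (norm v * norm w)"
    using assms by simp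
  with False show ?thesis
    using assms by (simp add: pairing_def real_sqrt_mult)
qed auto

definition matching :: "real \<Rightarrow> real \<Rightarrow> (real \<Rightarrow> 'a::real_inner) \<Rightarrow> (real \<Rightarrow> 'a) \<Rightarrow> real \<Rightarrow> real" where
  "matching a b f1 f2 u = pairing a b (curve_deriv f1 u) (curve_deriv f2 u)"

lemma dist_ab_matching:
  "dist_ab a b f1 f2 = 2 * b * sqrt (curve_length f1 + curve_length f2
     - 2 * (LINT u:{0..1}|lebesgue. matching a b f1 f2 u))"
  by (simp add: dist_ab_def matching_def pairing_def curve_angle_def cong: if_cong)

text \<open>
  The weighted inequality \<open>2 * sqrt (g * h) \<le> t * g + h / t\<close> is integrated and then optimized over
  \<open>t\<close>: the optimum is at \<open>t = sqrt (B / A)\<close>, and if \<open>A\<close> or \<open>B\<close> vanishes, \<open>t\<close> tends to infinity or to 0. For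
  \<open>t = 1\<close> the same inequality gives integrability.
\<close>
lemma Cauchy_Schwarz_sqrt_integral:
  fixes g h :: "real \<Rightarrow> real"
  assumes g: "(g has_integral A) {x..y}" and h: "(h has_integral B) {x..y}"
    and nn: "\<And>u. 0 \<le> g u" "\<And>u. 0 \<le> h u"
  shows "(\<lambda>u. sqrt (g u * h u)) absolutely_integrable_on {x..y}"
    and "integral {x..y} (\<lambda>u. sqrt (g u * h u)) \<le> sqrt (A * B)"
proof -
  have AB: "0 \<le> A" "0 \<le> B"
    using has_integral_nonneg[OF g] has_integral_nonneg[OF h] nn by auto
  have int: "g integrable_on {x..y}" "h integrable_on {x..y}"
    using g h by (auto simp: integrable_on_def)
  have meas: "g \<in> borel_measurable (lebesgue_on {x..y})" "h \<in> borel_measurable (lebesgue_on {x..y})"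
    using int by (auto intro: integrable_imp_measurable)
  have amgm: "2 * sqrt (p * q) \<le> t * p + q / t" if "0 < t" "0 \<le> p" "0 \<le> q" for t p q :: real
  proof -
    have "sqrt (p * q) = sqrt (t * p) * sqrt (q / t)"
      using that by (simp add: real_sqrt_mult[symmetric])
    moreover have "0 \<le> (sqrt (t * p) - sqrt (q / t))\<^sup>2" by simp
    ultimately show ?thesis using that by (simp add: power2_diff)
  qed
  show abs: "(\<lambda>u. sqrt (g u * h u)) absolutely_integrable_on {x..y}"
  proof (rule measurable_bounded_by_integrable_imp_absolutely_integrable)
    show "(\<lambda>u. sqrt (g u * h u)) \<in> borel_measurable (lebesgue_on {x..y})"
      using meas by measurable
    show "(\<lambda>u. g u + h u) integrable_on {x..y}"
      using int by (rule integrable_add)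
    show "norm (sqrt (g u * h u)) \<le> g u + h u" for u
      using amgm[of 1 "g u" "h u"] nn[of u] by simp
  qed simp
  then have int': "(\<lambda>u. sqrt (g u * h u)) integrable_on {x..y}"
    by (simp add: absolutely_integrable_on_def)
  have bound: "2 * integral {x..y} (\<lambda>u. sqrt (g u * h u)) \<le> t * A + B / t" if t: "0 < t" for t
  proof (rule has_integral_le)
    show "((\<lambda>u. 2 * sqrt (g u * h u)) has_integral 2 * integral {x..y} (\<lambda>u. sqrt (g u * h u))) {x..y}"
      using int' by (intro has_integral_mult_right integrable_integral)
    show "((\<lambda>u. t * g u + h u / t) has_integral (t * A + B / t)) {x..y}"
      by (intro has_integral_add has_integral_mult_right has_integral_divide g h)
  qed (use amgm[OF t] nn in auto)
  let ?I = "integral {x..y} (\<lambda>u. sqrt (g u * h u))"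
  show "?I \<le> sqrt (A * B)"
  proof (cases "A = 0 \<or> B = 0")
    case False
    then have pos: "0 < A" "0 < B" using AB by auto
    have "2 * ?I \<le> sqrt (B / A) * A + B / sqrt (B / A)"
      using pos by (intro bound) simp
    also have "sqrt (B / A) * A = sqrt (A * B)"
      using pos by (simp add: real_sqrt_divide real_sqrt_mult real_div_sqrt field_simps)
    also have "B / sqrt (B / A) = sqrt (A * B)"
      using pos by (simp add: real_sqrt_divide real_sqrt_mult real_div_sqrt field_simps)
    finally show ?thesis by simp
  next
    case True
    have "?I \<le> e" if "0 < e" for e
    proof (cases "A = 0")
      case True
      have "2 * ?I \<le> B / (B / e + 1)"
        using bound[of "B / e + 1"] True AB that by (simp add: add_nonneg_pos)
      also have "\<dots> \<le> e"
        using AB that by (simp add: field_simps add_nonneg_pos)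
      finally show ?thesis using that by simp
    next
      case A: False
      then have "B = 0" using True by simp
      then show ?thesis
        using bound[of "e / A"] A AB that by simp
    qed
    then have "?I \<le> 0"
      by (meson dense not_le)
    then show ?thesis using True by auto
  qed
qed

text \<open>
  Almost everywhere in the time interval the velocities are \<open>g1 u *\<^sub>R v\<close> and \<open>g2 u *\<^sub>R w\<close>. Homogeneity takes the constant
  pairing out of the integral, and the Cauchy--Schwarz inequality bounds what remains. It bounds only
  from above, so a negative pairing leaves 0 as the bound.
\<close>
lemma matching_cell:
  fixes c1 c2 :: "real \<Rightarrow> 'a::real_inner"
  assumes sp: "has_speed \<eta>1 g1" "has_speed \<eta>2 g2" and xy: "0 \<le> x" "x \<le> y" "y \<le> 1"
    and cell1: "s \<le> \<eta>1 x" "\<eta>1 y \<le> s'" "\<And>r. r \<in> {s..s'} \<Longrightarrow> c1 r = p + r *\<^sub>R v"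
    and cell2: "t \<le> \<eta>2 x" "\<eta>2 y \<le> t'" "\<And>r. r \<in> {t..t'} \<Longrightarrow> c2 r = q + r *\<^sub>R w"
  shows "matching a b (c1 \<circ> \<eta>1) (c2 \<circ> \<eta>2) absolutely_integrable_on {x..y}"
    and "integral {x..y} (matching a b (c1 \<circ> \<eta>1) (c2 \<circ> \<eta>2))
      \<le> max 0 (sqrt ((\<eta>1 y - \<eta>1 x) * (\<eta>2 y - \<eta>2 x)) * pairing a b v w)"
proof -
  have "\<eta>1 u \<in> {s..s'}" "\<eta>2 u \<in> {t..t'}" if "u \<in> {x..y}" for u
    using has_speed_mono[OF sp(1), of x u] has_speed_mono[OF sp(1), of u y]
      has_speed_mono[OF sp(2), of x u] has_speed_mono[OF sp(2), of u y] cell1 cell2 that xy by auto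
  then obtain N1 N2 where N: "negligible N1" "negligible N2"
    "\<And>u. u \<in> {x..y} - N1 \<Longrightarrow> curve_deriv (c1 \<circ> \<eta>1) u = g1 u *\<^sub>R v"
    "\<And>u. u \<in> {x..y} - N2 \<Longrightarrow> curve_deriv (c2 \<circ> \<eta>2) u = g2 u *\<^sub>R w"
    using curve_deriv_affine_comp[OF sp(1) xy(1,3) _ cell1(3)]
      curve_deriv_affine_comp[OF sp(2) xy(1,3) _ cell2(3)] by metis
  let ?h = "\<lambda>u. sqrt (g1 u * g2 u) * pairing a b v w"
  have eq: "matching a b (c1 \<circ> \<eta>1) (c2 \<circ> \<eta>2) u = ?h u" if "u \<in> {x..y} - (N1 \<union> N2)" for u
    using that N(3,4)[of u] has_speed_nonneg[OF sp(1)] has_speed_nonneg[OF sp(2)]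
    by (simp add: matching_def pairing_scaleR)
  have neg: "negligible (N1 \<union> N2)" using N by simp
  note CS = Cauchy_Schwarz_sqrt_integral[OF has_speed_integral[OF sp(1) xy] has_speed_integral[OF sp(2) xy]
      has_speed_nonneg[OF sp(1)] has_speed_nonneg[OF sp(2)]]
  have "?h absolutely_integrable_on {x..y}"
    using CS(1) by (rule set_integrable_mult_left)
  then show "matching a b (c1 \<circ> \<eta>1) (c2 \<circ> \<eta>2) absolutely_integrable_on {x..y}"
    using neg eq by (rule absolutely_integrable_spike)
  have "integral {x..y} (matching a b (c1 \<circ> \<eta>1) (c2 \<circ> \<eta>2)) = integral {x..y} ?h"
    using neg eq by (rule integral_spike[symmetric]) auto
  also have "\<dots> = integral {x..y} (\<lambda>u. sqrt (g1 u * g2 u)) * pairing a b v w"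
    by simp
  also have "\<dots> \<le> max 0 (sqrt ((\<eta>1 y - \<eta>1 x) * (\<eta>2 y - \<eta>2 x)) * pairing a b v w)"
  proof (cases "0 \<le> pairing a b v w")
    case True
    then show ?thesis using CS(2) by (intro max.coboundedI2 mult_right_mono)
  next
    case False
    have "0 \<le> integral {x..y} (\<lambda>u. sqrt (g1 u * g2 u))"
      by (rule integral_nonneg) (use CS(1) sp in \<open>auto simp: absolutely_integrable_on_def has_speed_nonneg\<close>)
    then show ?thesis using False by (intro max.coboundedI1) (simp add: mult_nonneg_nonpos)
  qed
  finally show "integral {x..y} (matching a b (c1 \<circ> \<eta>1) (c2 \<circ> \<eta>2))
      \<le> max 0 (sqrt ((\<eta>1 y - \<eta>1 x) * (\<eta>2 y - \<eta>2 x)) * pairing a b v w)" .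
qed

text \<open>
  A curve at rest has velocity 0, so horizontal and vertical segments gain nothing, even
  when the other curve passes corners meanwhile.
\<close>
lemma matching_of_const:
  fixes f1 f2 :: "real \<Rightarrow> 'a::real_inner"
  assumes xy: "0 \<le> x" "y \<le> 1" and const: "(\<forall>u\<in>{x..y}. f1 u = k1) \<or> (\<forall>u\<in>{x..y}. f2 u = k2)"
  shows "matching a b f1 f2 absolutely_integrable_on {x..y}"
    and "(matching a b f1 f2 has_integral 0) {x..y}"
proof -
  have 0: "curve_deriv f u = 0" if "\<forall>u\<in>{x..y}. f u = k" "u \<in> {x<..<y}" for f :: "real \<Rightarrow> 'a" and k u
  proof (rule curve_deriv_eqI)
    show "(f has_vector_derivative 0) (at u)"
      by (rule has_vector_derivative_transform_within_open[OF has_vector_derivative_const, where S = "{x<..<y}"])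
        (use that in auto)
  qed (use that xy in auto)
  have eq: "matching a b f1 f2 u = 0" if "u \<in> {x..y} - {x, y}" for u
    using const 0[of f1 k1 u] 0[of f2 k2 u] that by (auto simp: matching_def)
  show "matching a b f1 f2 absolutely_integrable_on {x..y}"
    by (rule absolutely_integrable_spike[where S = "{x, y}" and f = "\<lambda>_. 0"]) (use eq in auto)
  show "(matching a b f1 f2 has_integral 0) {x..y}"
    by (rule has_integral_spike[where S = "{x, y}" and f = "\<lambda>_. 0"]) (use eq in auto)
qed

section \<open>Chains of segments in the grid of breakpoints\<close>

locale polygonal_pair =
  fixes a b :: real and c1 c2 :: "real \<Rightarrow> 'a::euclidean_space"
    and n m :: nat and s t :: "nat \<Rightarrow> real" and p q v w :: "nat \<Rightarrow> 'a"
  assumes s0: "s 0 = 0" and sn: "s n = 1" and s_less: "\<And>i. i < n \<Longrightarrow> s i < s (Suc i)"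
    and t0: "t 0 = 0" and tm: "t m = 1" and t_less: "\<And>j. j < m \<Longrightarrow> t j < t (Suc j)"
    and c1: "\<And>i u. i < n \<Longrightarrow> u \<in> {s i..s (Suc i)} \<Longrightarrow> c1 u = p i + u *\<^sub>R v i"
    and c2: "\<And>j u. j < m \<Longrightarrow> u \<in> {t j..t (Suc j)} \<Longrightarrow> c2 u = q j + u *\<^sub>R w j"

text \<open>
  Adjoining one segment to every chain preserves compactness, if the admissible segments form a closed set on which the
  gain is continuous.
\<close>
lemma compact_extension:
  fixes R :: "('a::t2_space \<times> real) set" and G :: "'a \<times> 'a \<Rightarrow> real"
  assumes R: "compact R" and B: "compact B" and C: "closed C" and G: "continuous_on UNIV G"
  shows "compact {(z', f + G (z, z')) | z f z'. (z, f) \<in> R \<and> z' \<in> B \<and> (z, z') \<in> C}"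
proof -
  let ?S = "(R \<times> B) \<inter> (\<lambda>q. (fst (fst q), snd q)) -` C"
  let ?F = "\<lambda>q. (snd q, snd (fst q) + G (fst (fst q), snd q))"
  have "compact ?S"
    by (intro compact_Int_closed compact_Times R B closed_vimage C continuous_intros)
  moreover have "continuous_on ?S ?F"
    by (intro continuous_intros continuous_on_compose2[OF G]) auto
  ultimately have "compact (?F ` ?S)"
    by (intro compact_continuous_image)
  also have "?F ` ?S = {(z', f + G (z, z')) | z f z'. (z, f) \<in> R \<and> z' \<in> B \<and> (z, z') \<in> C}"
    by (force simp: image_iff)
  finally show ?thesis .
qed

context polygonal_pair
begin

definition cell_gain :: "nat \<Rightarrow> nat \<Rightarrow> real \<times> real \<Rightarrow> real \<times> real \<Rightarrow> real" where
  "cell_gain i j z z' = sqrt ((fst z' - fst z) * (snd z' - snd z)) * pairing a b (v i) (w j)"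

definition unit_le :: "real \<times> real \<Rightarrow> real \<times> real \<Rightarrow> bool" where
  "unit_le z z' \<longleftrightarrow> 0 \<le> fst z \<and> fst z \<le> fst z' \<and> fst z' \<le> 1 \<and> 0 \<le> snd z \<and> snd z \<le> snd z' \<and> snd z' \<le> 1"

definition in_cell :: "nat \<Rightarrow> nat \<Rightarrow> real \<times> real \<Rightarrow> real \<times> real \<Rightarrow> bool" where
  "in_cell i j z z' \<longleftrightarrow> s i \<le> fst z \<and> fst z' \<le> s (Suc i) \<and> t j \<le> snd z \<and> snd z' \<le> t (Suc j)"

text \<open>
  A segment may be horizontal or vertical, crossing cells freely and gaining nothing, or lie in one closed
  cell. A segment that lies in two closed cells lies on a grid line, so its gain is 0 by either rule.
\<close>
definition move :: "real \<times> real \<Rightarrow> real \<times> real \<Rightarrow> real \<Rightarrow> bool" where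
  "move z z' g \<longleftrightarrow> unit_le z z' \<and>
     ((fst z = fst z' \<or> snd z = snd z') \<and> g = 0 \<or>
      (\<exists>i<n. \<exists>j<m. in_cell i j z z' \<and> g = cell_gain i j z z'))"

primrec reach :: "nat \<Rightarrow> ((real \<times> real) \<times> real) set" where
  "reach 0 = {((0, 0), 0)}"
| "reach (Suc k) = {(z', f + g) | z f z' g. (z, f) \<in> reach k \<and> move z z' g}"

lemma reach_SucI: "(z, f) \<in> reach k \<Longrightarrow> move z z' g \<Longrightarrow> f' = f + g \<Longrightarrow> (z', f') \<in> reach (Suc k)"
  unfolding reach.simps by blast

lemma compact_reach: "compact (reach k)"
proof (induction k)
  case (Suc k)
  let ?B = "{0..1::real} \<times> {0..1::real}"
  let ?C = "{(z, z'). unit_le z z'}"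
  have B: "compact ?B" by (intro compact_Times compact_Icc)
  have C: "closed ?C"
    unfolding unit_le_def split_beta by (intro closed_Collect_conj closed_Collect_le continuous_intros)
  let ?D = "{(z, z'). fst z = fst z' \<or> snd z = snd (z' :: real \<times> real)} :: ((real \<times> real) \<times> (real \<times> real)) set"
  have D: "closed ?D"
    unfolding split_beta by (intro closed_Collect_disj closed_Collect_eq continuous_intros)
  have E: "closed {(z, z'). in_cell i j z z'}" for i j
    unfolding in_cell_def split_beta by (intro closed_Collect_conj closed_Collect_le continuous_intros)
  have G: "continuous_on UNIV (\<lambda>(z, z'). cell_gain i j z z')" for i j
    unfolding cell_gain_def split_beta by (intro continuous_intros)
  have "reach (Suc k) =
      {(z', f + (\<lambda>_. 0) (z, z')) | z f z'. (z, f) \<in> reach k \<and> z' \<in> ?B \<and> (z, z') \<in> ?C \<inter> ?D} \<union>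
      (\<Union>i<n. \<Union>j<m. {(z', f + (\<lambda>(z, z'). cell_gain i j z z') (z, z')) | z f z'.
         (z, f) \<in> reach k \<and> z' \<in> ?B \<and> (z, z') \<in> ?C \<inter> {(z, z'). in_cell i j z z'}})"
    (is "?L = ?R1 \<union> ?R2")
  proof (intro equalityI subsetI)
    fix y assume "y \<in> ?L"
    then obtain z f z' g where y: "y = (z', f + g)" "(z, f) \<in> reach k" and mv: "move z z' g" by auto
    then have "unit_le z z'" by (simp add: move_def)
    then have z': "(z, z') \<in> ?C" "z' \<in> ?B" by (auto simp: unit_le_def mem_Times_iff)
    from mv consider "fst z = fst z' \<or> snd z = snd z'" "g = 0"
      | i j where "i < n" "j < m" "in_cell i j z z'" "g = cell_gain i j z z'"
      unfolding move_def by blast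
    then show "y \<in> ?R1 \<union> ?R2"
    proof cases
      case 1
      with y z' have "y \<in> ?R1" by (intro CollectI exI[of _ z] exI[of _ f] exI[of _ z']) simp
      then show ?thesis ..
    next
      case 2
      with y z' have "y \<in> ?R2"
        by (intro UN_I[of i] UN_I[of j] CollectI exI[of _ z] exI[of _ f] exI[of _ z']) auto
      then show ?thesis ..
    qed
  next
    fix y assume "y \<in> ?R1 \<union> ?R2"
    then show "y \<in> ?L"
    proof
      assume "y \<in> ?R1"
      then obtain z f z' where "y = (z', f + 0)" "(z, f) \<in> reach k" "unit_le z z'" "fst z = fst z' \<or> snd z = snd z'"
        by auto
      then have "(z, f) \<in> reach k" "move z z' 0" "y = (z', f + 0)" by (auto simp: move_def)
      then show ?thesis by (auto intro: reach_SucI simp del: reach.simps)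
    next
      assume "y \<in> ?R2"
      then obtain i j z f z' where "i < n" "j < m" "y = (z', f + cell_gain i j z z')" "(z, f) \<in> reach k"
          "unit_le z z'" "in_cell i j z z'"
        by auto
      then have "(z, f) \<in> reach k" "move z z' (cell_gain i j z z')" "y = (z', f + cell_gain i j z z')"
        by (auto simp: move_def)
      then show ?thesis by (auto intro: reach_SucI simp del: reach.simps)
    qed
  qed
  also have "compact \<dots>"
    by (intro compact_Un compact_UN finite_lessThan compact_extension Suc.IH B closed_Int C D E G continuous_on_const)
  finally show ?case .
qed simp

lemma reach_unit: "(z, f) \<in> reach k \<Longrightarrow> unit_le z z"
proof (induction k arbitrary: z f)
  case (Suc k)
  then obtain z0 g where "move z0 z g" by auto
  then show ?case by (auto simp: move_def unit_le_def)
qed (auto simp: unit_le_def)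

lemma reach_mono: "k \<le> l \<Longrightarrow> reach k \<subseteq> reach l"
proof (rule lift_Suc_mono_le[of reach])
  show "reach k \<subseteq> reach (Suc k)" for k
  proof
    fix y assume y: "y \<in> reach k"
    obtain z f where zf: "y = (z, f)" by (cases y)
    then have "move z z 0" using reach_unit y by (auto simp: move_def)
    then show "y \<in> reach (Suc k)" using y reach_SucI[of z f k z 0 f] by (simp add: zf del: reach.simps)
  qed
qed

text \<open>
  If the gain of the diagonal segment is negative, the detour along two sides of the rectangle gains 0 instead. It costs two
  segments, which is why the number of segments grows by two.
\<close>
lemma reach_cell_step:
  assumes zf: "(z, f) \<in> reach k" and le: "unit_le z z'" and ij: "i < n" "j < m" "in_cell i j z z'"
  obtains f' where "(z', f') \<in> reach (k + 2)" "f + max 0 (cell_gain i j z z') \<le> f'"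
proof (cases "0 \<le> cell_gain i j z z'")
  case True
  have "move z z' (cell_gain i j z z')" using le ij by (auto simp: move_def)
  with zf have "(z', f + cell_gain i j z z') \<in> reach (Suc k)" by (rule reach_SucI) simp
  then have "(z', f + cell_gain i j z z') \<in> reach (k + 2)" using reach_mono[of "Suc k" "k + 2"] by (auto simp del: reach.simps)
  then show thesis using True by (intro that) auto
next
  case False
  have "move z (fst z', snd z) 0" "move (fst z', snd z) z' 0"
    using le by (auto simp: move_def unit_le_def)
  then have "(z', f) \<in> reach (Suc (Suc k))"
    by (intro reach_SucI[OF reach_SucI[OF zf]]) auto
  then show thesis using False by (intro that[of f]) (auto simp del: reach.simps)
qed

text \<open>
  The invariant of the induction over the grid: up to time \<open>u\<close> the path has collected no more than some
  chain of \<open>k\<close> segments ending at the same point.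
\<close>
definition matching_dominated :: "(real \<Rightarrow> real) \<Rightarrow> (real \<Rightarrow> real) \<Rightarrow> nat \<Rightarrow> real \<Rightarrow> bool" where
  "matching_dominated \<eta>1 \<eta>2 k u \<longleftrightarrow>
     matching a b (c1 \<circ> \<eta>1) (c2 \<circ> \<eta>2) absolutely_integrable_on {0..u} \<and>
     (\<exists>f. ((\<eta>1 u, \<eta>2 u), f) \<in> reach k \<and> integral {0..u} (matching a b (c1 \<circ> \<eta>1) (c2 \<circ> \<eta>2)) \<le> f)"

lemma matching_dominated_mono:
  "matching_dominated \<eta>1 \<eta>2 k u \<Longrightarrow> k \<le> l \<Longrightarrow> matching_dominated \<eta>1 \<eta>2 l u"
  using reach_mono[of k l] by (auto simp: matching_dominated_def simp del: reach.simps)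

lemma matching_dominated_cell:
  assumes sp: "has_speed \<eta>1 g1" "has_speed \<eta>2 g2"
    and dom: "matching_dominated \<eta>1 \<eta>2 k x" and xy: "0 \<le> x" "x \<le> y" "y \<le> 1"
    and ij: "i < n" "j < m" "in_cell i j (\<eta>1 x, \<eta>2 x) (\<eta>1 y, \<eta>2 y)"
  shows "matching_dominated \<eta>1 \<eta>2 (k + 2) y"
proof -
  let ?M = "matching a b (c1 \<circ> \<eta>1) (c2 \<circ> \<eta>2)"
  obtain f where f: "?M absolutely_integrable_on {0..x}" "((\<eta>1 x, \<eta>2 x), f) \<in> reach k" "integral {0..x} ?M \<le> f"
    using dom by (auto simp: matching_dominated_def)
  have "unit_le (\<eta>1 x, \<eta>2 x) (\<eta>1 y, \<eta>2 y)"
    using has_speed_mono[OF sp(1) xy] has_speed_mono[OF sp(2) xy] xy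
      has_speed_range[OF sp(1), of x] has_speed_range[OF sp(2), of x]
      has_speed_range[OF sp(1), of y] has_speed_range[OF sp(2), of y]
    by (simp add: unit_le_def)
  then obtain f' where f': "((\<eta>1 y, \<eta>2 y), f') \<in> reach (k + 2)"
      "f + max 0 (cell_gain i j (\<eta>1 x, \<eta>2 x) (\<eta>1 y, \<eta>2 y)) \<le> f'"
    using reach_cell_step[OF f(2) _ ij] by blast
  have cell: "s i \<le> \<eta>1 x" "\<eta>1 y \<le> s (Suc i)" "t j \<le> \<eta>2 x" "\<eta>2 y \<le> t (Suc j)"
    using ij(3) by (auto simp: in_cell_def)
  note mc = matching_cell[OF sp xy cell(1,2) c1[OF ij(1)] cell(3,4) c2[OF ij(2)], of a b]
  note app = absolutely_integrable_append[OF f(1) mc(1) xy(1,2)]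
  have "integral {0..y} ?M \<le> f'"
    using app(2) f(3) mc(2) f'(2) unfolding cell_gain_def fst_conv snd_conv by linarith
  with app(1) f'(1) show ?thesis
    unfolding matching_dominated_def by blast
qed

text \<open>
  In the last cell \<open>[s i', s (Suc i')] \<times> [t j', t (Suc j')]\<close> before \<open>(s i, t j)\<close>, the path is cut at the time \<open>x\<close> at
  which it has met both lower grid lines. From then on it stays in the cell, and at that time
  it lies on one of the two lines, where the induction hypothesis for the smaller grid
  applies. A path that has not yet left the left or lower side of the square has collected nothing, so one segment suffices.
\<close>
lemma matching_dominated_grid:
  assumes sp: "has_speed \<eta>1 g1" "has_speed \<eta>2 g2"
    and "i \<le> n" "j \<le> m" "u \<in> {0..1}" "\<eta>1 u \<le> s i" "\<eta>2 u \<le> t j"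
  shows "matching_dominated \<eta>1 \<eta>2 (2 * (i + j) + 1) u"
  using assms(3-)
proof (induction "i + j" arbitrary: i j u rule: less_induct)
  case less
  have r: "\<eta>1 u \<in> {0..1}" "\<eta>2 u \<in> {0..1}"
    using has_speed_range[OF sp(1)] has_speed_range[OF sp(2)] less.prems by auto
  have start: "matching_dominated \<eta>1 \<eta>2 (2 * (i + j) + 1) u" if z: "\<eta>1 u = 0 \<or> \<eta>2 u = 0"
  proof -
    have zero: "\<eta> x = 0" if "has_speed \<eta> g" "\<eta> u = 0" "x \<in> {0..u}" for \<eta> g x
      using has_speed_mono[of \<eta> g 0 x] has_speed_mono[of \<eta> g x u] that less.prems by (auto simp: has_speed_def)
    have "(\<forall>x\<in>{0..u}. (c1 \<circ> \<eta>1) x = c1 0) \<or> (\<forall>x\<in>{0..u}. (c2 \<circ> \<eta>2) x = c2 0)"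
      using zero[OF sp(1)] zero[OF sp(2)] z by auto
    note mc = matching_of_const[OF order_refl _ this, of a b]
    have "move (0, 0) (\<eta>1 u, \<eta>2 u) 0"
      using z r by (auto simp: move_def unit_le_def)
    then have "((\<eta>1 u, \<eta>2 u), 0) \<in> reach 1"
      by auto
    moreover have u1: "u \<le> 1" using less.prems by simp
    ultimately have "matching_dominated \<eta>1 \<eta>2 1 u"
      unfolding matching_dominated_def
      by (intro conjI exI[of _ 0] mc(1)) (simp_all only: integral_unique[OF mc(2)] order_refl)
    then show ?thesis by (rule matching_dominated_mono) simp
  qed
  show ?case
  proof (cases "i = 0 \<or> j = 0")
    case True
    then show ?thesis using start r less.prems s0 t0 by auto
  next
    case False
    then obtain i' j' where ij: "i = Suc i'" "j = Suc j'" by (metis not0_implies_Suc)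
    have nn: "0 \<le> s i'" "0 \<le> t j'"
      using partition_mono[where t = s and n = n and i = 0 and j = i', OF s_less]
        partition_mono[where t = t and n = m and i = 0 and j = j', OF t_less] s0 t0 less.prems ij by auto
    consider "\<eta>1 u \<le> s i'" | "\<eta>2 u \<le> t j'" | "s i' \<le> \<eta>1 u" "t j' \<le> \<eta>2 u" by linarith
    then show ?thesis
    proof cases
      case 1
      then have "matching_dominated \<eta>1 \<eta>2 (2 * (i' + j) + 1) u"
        using less.prems ij by (intro less.hyps) auto
      then show ?thesis by (rule matching_dominated_mono) (simp add: ij)
    next
      case 2
      then have "matching_dominated \<eta>1 \<eta>2 (2 * (i + j') + 1) u"
        using less.prems ij by (intro less.hyps) auto
      then show ?thesis by (rule matching_dominated_mono) (simp add: ij)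
    next
      case 3
      obtain u1 where u1: "0 \<le> u1" "u1 \<le> u" "\<eta>1 u1 = s i'"
        using has_speed_IVT[OF sp(1) less.prems(3) nn(1) 3(1)] .
      obtain u2 where u2: "0 \<le> u2" "u2 \<le> u" "\<eta>2 u2 = t j'"
        using has_speed_IVT[OF sp(2) less.prems(3) nn(2) 3(2)] .
      define x where "x = max u1 u2"
      have x: "0 \<le> x" "x \<le> u" "u \<le> 1" "x \<in> {0..1}" using u1 u2 less.prems by (auto simp: x_def)
      have le: "s i' \<le> \<eta>1 x" "t j' \<le> \<eta>2 x" "\<eta>1 x \<le> s i" "\<eta>2 x \<le> t j"
        using has_speed_mono[OF sp(1), of u1 x] has_speed_mono[OF sp(2), of u2 x]
          has_speed_mono[OF sp(1), of x u] has_speed_mono[OF sp(2), of x u] u1 u2 x less.prems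
        by (auto simp: x_def)
      have "matching_dominated \<eta>1 \<eta>2 (2 * (i' + j') + 3) x"
      proof (cases "u2 \<le> u1")
        case True
        then have "matching_dominated \<eta>1 \<eta>2 (2 * (i' + j) + 1) x"
          using less.prems ij x le u1 by (intro less.hyps) (auto simp: x_def)
        then show ?thesis by (rule matching_dominated_mono) (simp add: ij)
      next
        case False
        then have "matching_dominated \<eta>1 \<eta>2 (2 * (i + j') + 1) x"
          using less.prems ij x le u2 by (intro less.hyps) (auto simp: x_def)
        then show ?thesis by (rule matching_dominated_mono) (simp add: ij)
      qed
      then have "matching_dominated \<eta>1 \<eta>2 (2 * (i' + j') + 3 + 2) u"
        using le less.prems ij
        by (intro matching_dominated_cell[OF sp _ x(1-3), of _ i' j']) (auto simp: in_cell_def)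
      then show ?thesis by (rule matching_dominated_mono) (simp add: ij)
    qed
  qed
qed

end

section \<open>Piecewise linear paths realizing the chains\<close>

lemma partition_cover:
  fixes t :: "nat \<Rightarrow> real"
  assumes "t 0 \<le> u" "u \<le> t n" "u \<notin> t ` {..n}"
  obtains i where "i < n" "t i < u" "u < t (Suc i)"
proof -
  have "\<exists>i<k. t i < u \<and> u < t (Suc i)" if "k \<le> n" "u \<le> t k" for k
    using that
  proof (induction k)
    case 0
    then show ?case using assms(1,3) by (metis atMost_iff antisym image_eqI)
  next
    case (Suc k)
    show ?case
    proof (cases "u \<le> t k")
      case True
      then show ?thesis using Suc by (meson Suc_leD less_Suc_eq)
    next
      case False
      moreover have "u \<noteq> t (Suc k)" using assms(3) Suc.prems by blast
      ultimately show ?thesis using Suc.prems by (intro exI[of _ k]) auto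
    qed
  qed
  from this[of n] assms(2) show thesis using that by blast
qed

text \<open>
  Durations \<open>T\<close> other than 1 allow a chain to be realized segment by segment. Monotonicity and the Lipschitz
  condition are what puts such a function into \<open>Gamma_bar\<close> when \<open>T = x = 1\<close>.
\<close>
definition pl_ascent :: "real \<Rightarrow> real \<Rightarrow> (real \<Rightarrow> real) \<Rightarrow> bool" where
  "pl_ascent T x \<gamma> \<longleftrightarrow> \<gamma> 0 = 0 \<and> \<gamma> T = x \<and> mono_on {0..T} \<gamma> \<and> (\<exists>L. L-lipschitz_on {0..T} \<gamma>) \<and>
     (\<exists>n t. t 0 = 0 \<and> t n = T \<and> (\<forall>i<n. t i < t (Suc i)) \<and>
        (\<forall>i<n. \<exists>p v. \<forall>u\<in>{t i..t (Suc i)}. \<gamma> u = p + u *\<^sub>R v))"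

definition append_linear :: "(real \<Rightarrow> real) \<Rightarrow> real \<Rightarrow> real \<Rightarrow> real \<Rightarrow> real \<Rightarrow> real" where
  "append_linear \<gamma> T T' x' = (\<lambda>u. if u \<le> T then \<gamma> u else \<gamma> T + (u - T) * ((x' - \<gamma> T) / (T' - T)))"

lemma pl_ascent_append_linear:
  assumes pl: "pl_ascent T x \<gamma>" and T: "0 < T" "T < T'" and x: "x \<le> x'"
  shows "pl_ascent T' x' (append_linear \<gamma> T T' x')"
proof -
  define k where "k = (x' - x) / (T' - T)"
  have k: "0 \<le> k" using T x by (simp add: k_def)
  have pl': "\<gamma> 0 = 0" "\<gamma> T = x" "mono_on {0..T} \<gamma>" using pl by (auto simp: pl_ascent_def)
  have eq: "append_linear \<gamma> T T' x' = (\<lambda>u. if u \<le> T then \<gamma> u else x + (u - T) * k)"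
    by (simp add: append_linear_def k_def pl' fun_eq_iff)
  have "\<exists>L. L-lipschitz_on {0..T'} (append_linear \<gamma> T T' x')"
  proof -
    obtain L where "L-lipschitz_on {0..T} \<gamma>" using pl by (auto simp: pl_ascent_def)
    moreover have "\<bar>k\<bar>-lipschitz_on {T..T'} (\<lambda>u. x + (u - T) * k)"
      by (rule lipschitz_onI) (auto simp: dist_real_def algebra_simps abs_mult[symmetric])
    ultimately have "(max L \<bar>k\<bar>)-lipschitz_on {0..T'} (append_linear \<gamma> T T' x')"
      unfolding eq by (rule lipschitz_on_concat_max) (simp add: pl')
    then show ?thesis by blast
  qed
  moreover have "mono_on {0..T'} (append_linear \<gamma> T T' x')"
    unfolding eq
  proof (rule mono_onI)
    fix u w assume uw: "u \<in> {0..T'}" "w \<in> {0..T'}" "u \<le> w"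
    have "\<gamma> u \<le> x" if "u \<le> T"
      using mono_onD[OF pl'(3), of u T] that uw pl' T by auto
    moreover have "\<gamma> u \<le> \<gamma> w" if "w \<le> T"
      using mono_onD[OF pl'(3), of u w] that uw by auto
    moreover have "0 \<le> (w - T) * k" if "T \<le> w" using that k by simp
    moreover have "(u - T) * k \<le> (w - T) * k" using uw k by (intro mult_right_mono) auto
    ultimately show "(if u \<le> T then \<gamma> u else x + (u - T) * k) \<le> (if w \<le> T then \<gamma> w else x + (w - T) * k)"
      using uw by (smt (verit, best))
  qed
  moreover have "\<exists>n t. t 0 = 0 \<and> t n = T' \<and> (\<forall>i<n. t i < t (Suc i)) \<and>
        (\<forall>i<n. \<exists>p v. \<forall>u\<in>{t i..t (Suc i)}. append_linear \<gamma> T T' x' u = p + u *\<^sub>R v)"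
  proof -
    obtain n t where t: "t 0 = 0" "t n = T" "\<And>i. i < n \<Longrightarrow> t i < t (Suc i)"
      "\<And>i. i < n \<Longrightarrow> \<exists>p v. \<forall>u\<in>{t i..t (Suc i)}. \<gamma> u = p + u *\<^sub>R v"
      using pl by (auto simp: pl_ascent_def)
    define t' where "t' i = (if i \<le> n then t i else T')" for i
    have "\<exists>p v. \<forall>u\<in>{t' i..t' (Suc i)}. append_linear \<gamma> T T' x' u = p + u *\<^sub>R v" if i: "i < Suc n" for i
    proof (cases "i < n")
      case True
      have "t (Suc i) \<le> T" using partition_mono[where t=t and n=n and i="Suc i" and j=n, OF t(3)] True t(2) by auto
      moreover obtain p v where "\<forall>u\<in>{t i..t (Suc i)}. \<gamma> u = p + u *\<^sub>R v" using t(4) True by blast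
      ultimately have "\<forall>u\<in>{t' i..t' (Suc i)}. append_linear \<gamma> T T' x' u = p + u *\<^sub>R v"
        using True by (auto simp: t'_def eq)
      then show ?thesis by blast
    next
      case False
      then have "i = n" using i by simp
      then have "\<forall>u\<in>{t' i..t' (Suc i)}. append_linear \<gamma> T T' x' u = (x - T * k) + u *\<^sub>R k"
        using t(2) pl'(2) by (auto simp: t'_def eq algebra_simps)
      then show ?thesis by blast
    qed
    then show ?thesis
      using t T by (intro exI[of _ "Suc n"] exI[of _ t']) (auto simp: t'_def less_Suc_eq)
  qed
  moreover have "append_linear \<gamma> T T' x' 0 = 0" "append_linear \<gamma> T T' x' T' = x'"
    using T pl' by (auto simp: append_linear_def)
  ultimately show ?thesis by (simp add: pl_ascent_def)
qed

lemma pl_ascent_zero: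
  assumes "0 < T"
  shows "pl_ascent T 0 (\<lambda>_. 0)"
proof -
  have "0-lipschitz_on {0..T} (\<lambda>_. 0::real)" by (rule lipschitz_onI) auto
  moreover have "mono_on {0..T} (\<lambda>_. 0::real)" by (rule mono_onI) simp
  moreover have "\<exists>n t. t 0 = 0 \<and> t n = T \<and> (\<forall>i<n. t i < t (Suc i)) \<and>
        (\<forall>i<n. \<exists>p v. \<forall>u\<in>{t i..t (Suc i)}. (0::real) = p + u *\<^sub>R v)"
    using assms
    by (intro exI[of _ "Suc 0"] exI[of _ "\<lambda>i. if i = 0 then 0 else T"]) (auto intro: exI[of _ 0])
  ultimately show ?thesis unfolding pl_ascent_def by blast
qed

lemma lipschitz_on_imp_absolutely_continuous_curve:
  assumes "L-lipschitz_on {0..1} c"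
  shows "absolutely_continuous_curve c"
  unfolding absolutely_continuous_curve_def
proof (intro allI impI)
  fix \<epsilon> :: real assume \<epsilon>: "0 < \<epsilon>"
  have L: "0 \<le> L" using assms by (rule lipschitz_on_nonneg)
  show "\<exists>\<delta>>0. \<forall>(n::nat) l r.
        (\<forall>i<n. 0 \<le> l i \<and> l i \<le> r i \<and> r i \<le> 1) \<and>
        disjoint_family_on (\<lambda>i. {l i<..<r i}) {..<n} \<and>
        (\<Sum>i<n. r i - l i) < \<delta> \<longrightarrow>
        (\<Sum>i<n. norm (c (r i) - c (l i))) < \<epsilon>"
  proof (intro exI[of _ "\<epsilon> / (L + 1)"] conjI allI impI)
    show "0 < \<epsilon> / (L + 1)" using \<epsilon> L by simp
    fix n :: nat and l r :: "nat \<Rightarrow> real"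
    assume A: "(\<forall>i<n. 0 \<le> l i \<and> l i \<le> r i \<and> r i \<le> 1) \<and>
        disjoint_family_on (\<lambda>i. {l i<..<r i}) {..<n} \<and> (\<Sum>i<n. r i - l i) < \<epsilon> / (L + 1)"
    have "(\<Sum>i<n. norm (c (r i) - c (l i))) \<le> (\<Sum>i<n. (L + 1) * (r i - l i))"
    proof (rule sum_mono)
      fix i assume "i \<in> {..<n}"
      then have i: "0 \<le> l i" "l i \<le> r i" "r i \<le> 1" using A by auto
      then have "norm (c (r i) - c (l i)) \<le> L * (r i - l i)"
        using lipschitz_onD[OF assms, of "r i" "l i"] by (auto simp: dist_norm)
      also have "\<dots> \<le> (L + 1) * (r i - l i)" using i by (intro mult_right_mono) auto
      finally show "norm (c (r i) - c (l i)) \<le> (L + 1) * (r i - l i)" .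
    qed
    also have "\<dots> = (L + 1) * (\<Sum>i<n. r i - l i)" by (simp add: sum_distrib_left)
    also have "\<dots> < \<epsilon>" using A L by (simp add: field_simps)
    finally show "(\<Sum>i<n. norm (c (r i) - c (l i))) < \<epsilon>" .
  qed
qed

lemma pl_ascent_unit:
  assumes "pl_ascent 1 1 \<gamma>"
  shows "piecewise_linear \<gamma>" and "\<gamma> \<in> Gamma_bar"
proof -
  obtain L n t where pl: "\<gamma> 0 = 0" "\<gamma> 1 = 1" "mono_on {0..1} \<gamma>" "L-lipschitz_on {0..1} \<gamma>"
    "t 0 = 0" "t n = 1" "\<And>i. i < n \<Longrightarrow> t i < t (Suc i)"
    "\<And>i. i < n \<Longrightarrow> \<exists>p v. \<forall>u\<in>{t i..t (Suc i)}. \<gamma> u = p + u *\<^sub>R v"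
    using assms unfolding pl_ascent_def by blast
  show "piecewise_linear \<gamma>"
    using assms lipschitz_on_continuous_on[OF pl(4)] by (auto simp: pl_ascent_def piecewise_linear_def)
  have der: "\<exists>D\<ge>0. (\<gamma> has_real_derivative D) (at u within {0..1})" if u: "u \<in> {0..1} - t ` {..n}" for u
  proof -
    obtain i where i: "i < n" "t i < u" "u < t (Suc i)"
      using partition_cover[of t u n] u pl(5,6) by auto
    obtain p v where pv: "\<forall>u\<in>{t i..t (Suc i)}. \<gamma> u = p + u *\<^sub>R v" using pl(8)[OF i(1)] by blast
    have ti: "0 \<le> t i" "t (Suc i) \<le> 1"
      using partition_mono[where t=t and n=n and i=0 and j=i, OF pl(7)]
        partition_mono[where t=t and n=n and i="Suc i" and j=n, OF pl(7)] i(1) pl(5,6) by auto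
    have "\<gamma> (t i) \<le> \<gamma> (t (Suc i))"
      using mono_onD[OF pl(3), of "t i" "t (Suc i)"] ti i by auto
    then have "t i * v \<le> t (Suc i) * v" using pv i by auto
    then have "0 \<le> v" using i by (simp add: mult_le_cancel_right)
    moreover have "((\<lambda>u. p + u *\<^sub>R v) has_real_derivative v) (at u within {0..1})"
      by (auto intro!: derivative_eq_intros)
    then have "(\<gamma> has_real_derivative v) (at u within {0..1})"
      by (rule has_field_derivative_transform_within[where d = "min (u - t i) (t (Suc i) - u)"])
        (use i u pv in \<open>auto simp: dist_real_def abs_less_iff\<close>)
    ultimately show ?thesis by blast
  qed
  have "AE u in lebesgue. u \<notin> t ` {..n}"
    by (intro AE_not_in) (simp add: negligible_finite flip: negligible_iff_null_sets)
  then have "AE u in lebesgue_on {0..1}. \<exists>D\<ge>0. (\<gamma> has_real_derivative D) (at u within {0..1})"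
    by (auto simp: AE_restrict_space_iff intro: der elim!: eventually_mono)
  moreover have "\<gamma> ` {0..1} \<subseteq> {0..1}"
    using mono_onD[OF pl(3), of 0] mono_onD[OF pl(3), of _ 1] pl(1,2) by fastforce
  ultimately show "\<gamma> \<in> Gamma_bar"
    using lipschitz_on_imp_absolutely_continuous_curve[OF pl(4)] pl(1,2) by (auto simp: Gamma_bar_def)
qed

lemma curve_deriv_cong:
  assumes "open S" "u \<in> S" "\<And>x. x \<in> S \<Longrightarrow> f x = g x"
  shows "curve_deriv f u = curve_deriv g u"
proof -
  have "eventually (\<lambda>x. x \<in> S) (nhds u)" using assms by (simp add: eventually_nhds_in_open)
  then have "eventually (\<lambda>x. x \<in> {0..1} \<longrightarrow> f x = g x) (nhds u)"
    by (rule eventually_mono) (simp add: assms)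
  then have "(f has_vector_derivative D) (at u within {0..1}) \<longleftrightarrow> (g has_vector_derivative D) (at u within {0..1})" for D
    by (rule has_vector_derivative_cong_ev) (simp add: assms)
  then show ?thesis by (simp add: curve_deriv_def vector_derivative_def)
qed

lemma curve_deriv_append_linear:
  assumes T: "0 < T" "T < T'" "T' \<le> 1" and st: "s \<le> \<gamma> T" "x' \<le> s'" "\<gamma> T \<le> x'"
    and c: "\<And>r. r \<in> {s..s'} \<Longrightarrow> c r = p + r *\<^sub>R v" and u: "u \<in> {T<..<T'}"
  shows "curve_deriv (c \<circ> append_linear \<gamma> T T' x') u = ((x' - \<gamma> T) / (T' - T)) *\<^sub>R v"
proof (rule curve_deriv_eqI)
  define k where "k = (x' - \<gamma> T) / (T' - T)"
  have k: "0 \<le> k" using T st by (simp add: k_def)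
  have "((\<lambda>u. p + (\<gamma> T + (u - T) * k) *\<^sub>R v) has_vector_derivative k *\<^sub>R v) (at u)"
    by (auto intro!: derivative_eq_intros)
  then show "((c \<circ> append_linear \<gamma> T T' x') has_vector_derivative ((x' - \<gamma> T) / (T' - T)) *\<^sub>R v) (at u)"
    unfolding k_def[symmetric]
  proof (rule has_vector_derivative_transform_within_open[where S = "{T<..<T'}"])
    fix y assume y: "y \<in> {T<..<T'}"
    have "(y - T) * k \<le> (T' - T) * k" using y k by (intro mult_right_mono) auto
    also have "\<dots> = x' - \<gamma> T" using T by (simp add: k_def)
    finally have "(y - T) * k \<le> x' - \<gamma> T" .
    moreover have "0 \<le> (y - T) * k" using y k by simp
    ultimately have "\<gamma> T + (y - T) * k \<in> {s..s'}" using st by auto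
    with c y show "p + (\<gamma> T + (y - T) * k) *\<^sub>R v = (c \<circ> append_linear \<gamma> T T' x') y"
      by (simp add: append_linear_def k_def)
  qed (use u in auto)
qed (use u T in auto)

context polygonal_pair
begin

text \<open>
  The last segment of a chain is traversed linearly during the second half of the time interval, the remaining chain
  during the first half. Stating the claim for every duration \<open>T\<close> makes a rescaling of paths
  unnecessary.
\<close>
lemma reach_realized:
  assumes "(z, f) \<in> reach k" "0 < T" "T \<le> 1"
  shows "\<exists>\<gamma>1 \<gamma>2. pl_ascent T (fst z) \<gamma>1 \<and> pl_ascent T (snd z) \<gamma>2 \<and>
    matching a b (c1 \<circ> \<gamma>1) (c2 \<circ> \<gamma>2) absolutely_integrable_on {0..T} \<and>
    integral {0..T} (matching a b (c1 \<circ> \<gamma>1) (c2 \<circ> \<gamma>2)) = f"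
  using assms
proof (induction k arbitrary: z f T)
  case 0
  have "\<forall>u\<in>{0..T}. (c1 \<circ> (\<lambda>_. 0)) u = c1 0" by simp
  note mc = matching_of_const[OF order_refl 0(3) disjI1[OF this], of a b "c2 \<circ> (\<lambda>_. 0)"]
  from 0 have "z = (0, 0)" "f = 0" by auto
  then show ?case
    using pl_ascent_zero[OF 0(2)] mc(1) integral_unique[OF mc(2)]
    by (intro exI[of _ "\<lambda>_. 0"]) simp
next
  case (Suc k)
  from Suc.prems(1) obtain z0 f0 g where z0: "(z0, f0) \<in> reach k" "move z0 z g" "f = f0 + g"
    unfolding reach.simps by blast
  define T0 where "T0 = T / 2"
  have T0: "0 < T0" "T0 < T" "T0 \<le> 1" "0 \<le> T0" "T0 \<le> T" using Suc.prems by (auto simp: T0_def)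
  obtain \<gamma>1 \<gamma>2 where \<gamma>: "pl_ascent T0 (fst z0) \<gamma>1" "pl_ascent T0 (snd z0) \<gamma>2"
      "matching a b (c1 \<circ> \<gamma>1) (c2 \<circ> \<gamma>2) absolutely_integrable_on {0..T0}"
      "integral {0..T0} (matching a b (c1 \<circ> \<gamma>1) (c2 \<circ> \<gamma>2)) = f0"
    using Suc.IH[OF z0(1) T0(1,3)] by blast
  have end0: "\<gamma>1 T0 = fst z0" "\<gamma>2 T0 = snd z0" using \<gamma>(1,2) by (auto simp: pl_ascent_def)
  have le: "fst z0 \<le> fst z" "snd z0 \<le> snd z" using z0(2) by (auto simp: move_def unit_le_def)
  let ?\<delta>1 = "append_linear \<gamma>1 T0 T (fst z)" and ?\<delta>2 = "append_linear \<gamma>2 T0 T (snd z)"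
  let ?M = "matching a b (c1 \<circ> ?\<delta>1) (c2 \<circ> ?\<delta>2)"
  have old: "?M u = matching a b (c1 \<circ> \<gamma>1) (c2 \<circ> \<gamma>2) u" if "u \<in> {0..T0} - {0, T0}" for u
    unfolding matching_def using that
    by (intro arg_cong2[where f = "pairing a b"] curve_deriv_cong[where S = "{0<..<T0}"])
      (auto simp: append_linear_def)
  have M0: "?M absolutely_integrable_on {0..T0}"
    by (rule absolutely_integrable_spike[OF \<gamma>(3), where S = "{0, T0}"]) (use old in auto)
  have I0: "integral {0..T0} ?M = f0"
    unfolding \<gamma>(4)[symmetric] by (rule integral_spike[where S = "{0, T0}"]) (use old in auto)
  have new: "?M absolutely_integrable_on {T0..T} \<and> integral {T0..T} ?M = g"
  proof -
    from z0(2) consider "fst z0 = fst z \<or> snd z0 = snd z" "g = 0"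
      | i j where "i < n" "j < m" "in_cell i j z0 z" "g = cell_gain i j z0 z"
      unfolding move_def by blast
    then show ?thesis
    proof cases
      case 1
      then have "(\<forall>u\<in>{T0..T}. (c1 \<circ> ?\<delta>1) u = c1 (fst z)) \<or> (\<forall>u\<in>{T0..T}. (c2 \<circ> ?\<delta>2) u = c2 (snd z))"
        by (auto simp: append_linear_def end0)
      note mc = matching_of_const[OF T0(4) Suc.prems(3) this, of a b]
      show ?thesis using mc(1) integral_unique[OF mc(2)] 1(2) by blast
    next
      case 2
      let ?h = "T - T0" and ?dx = "fst z - fst z0" and ?dy = "snd z - snd z0"
      have eq: "?M u = g / ?h" if "u \<in> {T0..T} - {T0, T}" for u
      proof -
        have u: "u \<in> {T0<..<T}" using that by auto
        have cell: "s i \<le> \<gamma>1 T0" "fst z \<le> s (Suc i)" "\<gamma>1 T0 \<le> fst z" "t j \<le> \<gamma>2 T0" "snd z \<le> t (Suc j)" "\<gamma>2 T0 \<le> snd z"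
          using 2(3) le by (auto simp: in_cell_def end0)
        have "?M u = pairing a b ((?dx / ?h) *\<^sub>R v i) ((?dy / ?h) *\<^sub>R w j)"
          using curve_deriv_append_linear[where c = c1 and p = "p i" and v = "v i" and \<gamma> = \<gamma>1, OF T0(1,2) Suc.prems(3) cell(1-3) c1[OF 2(1)] u]
            curve_deriv_append_linear[where c = c2 and p = "q j" and v = "w j" and \<gamma> = \<gamma>2, OF T0(1,2) Suc.prems(3) cell(4-6) c2[OF 2(2)] u]
          unfolding matching_def end0 by simp
        also have "\<dots> = sqrt (?dx / ?h * (?dy / ?h)) * pairing a b (v i) (w j)"
          using le T0 by (intro pairing_scaleR) auto
        also have "?dx / ?h * (?dy / ?h) = (?dx * ?dy) / ?h\<^sup>2" by (simp add: power2_eq_square)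
        also have "sqrt \<dots> = sqrt (?dx * ?dy) / ?h" using T0 by (simp add: real_sqrt_divide)
        finally show ?thesis by (simp add: 2(4) cell_gain_def del: comp_apply)
      qed
      have "((\<lambda>_. g / ?h) has_integral ?h *\<^sub>R (g / ?h)) {T0..T}"
        using T0 has_integral_const_real[of "g / ?h" T0 T] by simp
      then have "integral {T0..T} (\<lambda>_. g / ?h) = g" using T0 by (simp add: integral_unique)
      moreover have "integral {T0..T} ?M = integral {T0..T} (\<lambda>_. g / ?h)"
        by (rule integral_spike[where S = "{T0, T}"]) (use eq in auto)
      moreover have "?M absolutely_integrable_on {T0..T}"
        by (rule absolutely_integrable_spike[where S = "{T0, T}" and f = "\<lambda>_. g / ?h"]) (use eq in auto)
      ultimately show ?thesis by simp
    qed
  qed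
  note app = absolutely_integrable_append[OF M0 conjunct1[OF new] T0(4,5)]
  show ?case
    using pl_ascent_append_linear[OF \<gamma>(1) T0(1,2) le(1)] pl_ascent_append_linear[OF \<gamma>(2) T0(1,2) le(2)]
      app(1) app(2)[unfolded I0 conjunct2[OF new]] z0(3) by blast
qed

end

section \<open>Attainment of the infimum\<close>

theorem theorem4p1:
  fixes c1 c2 :: "real \<Rightarrow> real ^ 'd"
    and a b :: real
  assumes "CARD('d) \<ge> 2"
    and "a > 0" and "b > 0"
    and "piecewise_linear c1" and "piecewise_linear c2"
  shows "\<exists>\<gamma>1\<in>Gamma_bar. \<exists>\<gamma>2\<in>Gamma_bar.
           piecewise_linear \<gamma>1 \<and> piecewise_linear \<gamma>2 \<and>
           dist_ab a b (c1 \<circ> \<gamma>1) (c2 \<circ> \<gamma>2) =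
             (INF (\<eta>1, \<eta>2)\<in>Gamma_bar \<times> Gamma_bar. dist_ab a b (c1 \<circ> \<eta>1) (c2 \<circ> \<eta>2))"
proof -
  obtain n s where s: "s 0 = 0" "s n = 1" "\<And>i. i < n \<Longrightarrow> s i < s (Suc i)"
      "\<forall>i\<in>{..<n}. \<exists>p v. \<forall>u\<in>{s i..s (Suc i)}. c1 u = p + u *\<^sub>R v"
    using assms(4) unfolding piecewise_linear_def by blast
  obtain p v where c1: "\<And>i u. i < n \<Longrightarrow> u \<in> {s i..s (Suc i)} \<Longrightarrow> c1 u = p i + u *\<^sub>R v i"
    by (metis bchoice lessThan_iff s(4))
  obtain m t where t: "t 0 = 0" "t m = 1" "\<And>j. j < m \<Longrightarrow> t j < t (Suc j)"
      "\<forall>j\<in>{..<m}. \<exists>q w. \<forall>u\<in>{t j..t (Suc j)}. c2 u = q + u *\<^sub>R w"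
    using assms(5) unfolding piecewise_linear_def by blast
  obtain q w where c2: "\<And>j u. j < m \<Longrightarrow> u \<in> {t j..t (Suc j)} \<Longrightarrow> c2 u = q j + u *\<^sub>R w j"
    by (metis bchoice lessThan_iff t(4))
  interpret polygonal_pair a b c1 c2 n m s t p q v w
    by unfold_locales (use s t c1 c2 in auto)
  define N where "N = 2 * (n + m) + 1"
  define F where "F = {f. ((1, 1), f) \<in> reach N}"
  have "compact (snd ` (reach N \<inter> ({(1, 1)} \<times> UNIV)))"
    by (intro compact_continuous_image compact_Int_closed compact_reach closed_Times continuous_intros closed_singleton closed_UNIV)
  also have "snd ` (reach N \<inter> ({(1, 1)} \<times> UNIV)) = F" by (force simp: F_def)
  finally have "compact F" .
  have n: "n \<noteq> 0" using s by (metis zero_neq_one)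
  \<comment> \<open>Two sides of the square form a chain to the corner, so there is a gain to maximize.\<close>
  have "((1, 1), 0) \<in> reach (Suc (Suc 0))"
    by (rule reach_SucI[OF reach_SucI[of "(0, 0)" 0 0 "(1, 0)" 0]]) (auto simp: move_def unit_le_def)
  then have "0 \<in> F" using n reach_mono[of "Suc (Suc 0)" N] by (auto simp: F_def N_def simp del: reach.simps)
  then obtain f where f: "f \<in> F" "\<And>f'. f' \<in> F \<Longrightarrow> f' \<le> f"
    using compact_attains_sup[OF \<open>compact F\<close>] by blast
  obtain \<gamma>1 \<gamma>2 where \<gamma>: "pl_ascent 1 1 \<gamma>1" "pl_ascent 1 1 \<gamma>2"
      "matching a b (c1 \<circ> \<gamma>1) (c2 \<circ> \<gamma>2) absolutely_integrable_on {0..1}"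
      "integral {0..1} (matching a b (c1 \<circ> \<gamma>1) (c2 \<circ> \<gamma>2)) = f"
    using reach_realized[of "(1, 1)" f N 1] f(1) by (auto simp: F_def)
  note \<gamma>G = pl_ascent_unit[OF \<gamma>(1)] pl_ascent_unit[OF \<gamma>(2)]
  let ?L = "(\<Sum>i<n. (s (Suc i) - s i) * norm (v i)) + (\<Sum>j<m. (t (Suc j) - t j) * norm (w j))"
  have len: "curve_length (c1 \<circ> \<eta>1) + curve_length (c2 \<circ> \<eta>2) = ?L"
    if \<eta>: "\<eta>1 \<in> Gamma_bar" "\<eta>2 \<in> Gamma_bar" for \<eta>1 \<eta>2
  proof -
    obtain g1 g2 where "has_speed \<eta>1 g1" "has_speed \<eta>2 g2"
      using Gamma_bar_has_speed \<eta> by metis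
    then show ?thesis
      using curve_length_reparametrized[of \<eta>1 g1 s n c1 p v] curve_length_reparametrized[of \<eta>2 g2 t m c2 q w]
        s t c1 c2 by simp
  qed
  have opt: "dist_ab a b (c1 \<circ> \<gamma>1) (c2 \<circ> \<gamma>2) = 2 * b * sqrt (?L - 2 * f)"
    using len \<gamma>G \<gamma>(3,4) by (simp add: dist_ab_matching set_lebesgue_integral_eq_integral)
  have lower: "2 * b * sqrt (?L - 2 * f) \<le> dist_ab a b (c1 \<circ> \<eta>1) (c2 \<circ> \<eta>2)"
    if \<eta>: "\<eta>1 \<in> Gamma_bar" "\<eta>2 \<in> Gamma_bar" for \<eta>1 \<eta>2
  proof -
    obtain g1 g2 where sp: "has_speed \<eta>1 g1" "has_speed \<eta>2 g2"
      using Gamma_bar_has_speed \<eta> by metis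
    have e: "\<eta>1 1 = 1" "\<eta>2 1 = 1" using sp by (auto simp: has_speed_def)
    have "matching_dominated \<eta>1 \<eta>2 N 1"
      unfolding N_def using matching_dominated_grid[OF sp, of n m 1] e s t by simp
    then have M: "matching a b (c1 \<circ> \<eta>1) (c2 \<circ> \<eta>2) absolutely_integrable_on {0..1}"
      "integral {0..1} (matching a b (c1 \<circ> \<eta>1) (c2 \<circ> \<eta>2)) \<le> f"
      using f(2) e by (force simp: matching_dominated_def F_def simp del: reach.simps)+
    show ?thesis
      using M len[OF \<eta>] assms(3) by (simp add: dist_ab_matching set_lebesgue_integral_eq_integral)
  qed
  have "dist_ab a b (c1 \<circ> \<gamma>1) (c2 \<circ> \<gamma>2) =
      (INF (\<eta>1, \<eta>2)\<in>Gamma_bar \<times> Gamma_bar. dist_ab a b (c1 \<circ> \<eta>1) (c2 \<circ> \<eta>2))"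
  proof (rule cInf_eq_minimum[symmetric])
    show "dist_ab a b (c1 \<circ> \<gamma>1) (c2 \<circ> \<gamma>2) \<in>
        (\<lambda>(\<eta>1, \<eta>2). dist_ab a b (c1 \<circ> \<eta>1) (c2 \<circ> \<eta>2)) ` (Gamma_bar \<times> Gamma_bar)"
      using \<gamma>G by (intro image_eqI[of _ _ "(\<gamma>1, \<gamma>2)"]) auto
  qed (use lower opt in auto)
  with \<gamma>G show ?thesis by blast
qed

end
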